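(* Let $T$ be an $n$-string link with a fixed abstract closure $\sigma$ to an oriented circle and a fixed point $\infty\in\partial T$, and let $m$ be the meridian of a positive quadruple crossing. Put $$R^{(1)}(m)=\sum_{p}\mathrm{sign}(p)\,W_1(p)\,\sigma_2\sigma_1(p)+\sum_{p}\mathrm{sign}(p)\,z\,W_2(p)\,(\sigma_2(p)-\sigma_1(p))\in S(\partial T),$$ where the first sum is over all triple crossings $p$ in $m$ of global type $l_c$ or $r_a$ and the second sum is over all triple crossings $p$ in $m$ whose distinguished crossing $d$ is of type $0$ (global types $r_a,r_b,l_b$). Then $R^{(1)}(m)=0$.
   Context: Setting. An $n$-string link $T$ consists of $n$ ordered, oriented, properly and smoothly embedded arcs in the cube $I^3=I^2\times I$, considered via the orthogonal projection $pr:I^3\to I^2$. Abstract arcs $\sigma$ are added (not embedded) so that $T\cup\sigma$ is one oriented circle; $\infty$ is a point of $\partial T$ on this circle. $S(\partial T)$ is the HOMFLYPT skein module over $\mathbb{Z}[v^{\pm1},z^{\pm1}]$ of oriented tangle diagrams up to regular isotopy with oriented boundary $\partial T$: (positive crossing) $-$ (negative crossing) $= z\cdot$(oriented smoothing), a positive (negative) kink contributes $v$ ($v^{-1}$), and a trivial component contributes $\delta=(v-v^{-1})/z$. Crossings. Starting at $\infty$ and following the oriented circle, a crossing $q$ is of type $1$ if its under-cross is met before its over-cross, and of type $0$ otherwise. $w(q)=\pm1$ is the writhe of $q$. Triple crossings. At a triple crossing $p$ the three branches are called low, mid, high according to height. The distinguished crossing $d$ is between low and high, $hm$ is between high and mid,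 $ml$ is between mid and low. The global type of $p$ is determined by the order in which the branches are met from $\infty$: $r_a$: mid, high, low; $r_b$: high, low, mid; $l_b$: high, mid, low; $l_c$: mid, low, high. When $d$ is of type $0$, an f-crossing of $p$ is a crossing $q\neq d$ of type $1$ whose under-cross lies on the oriented arc from $\infty$ to the over-cross of $d$. Weights. For a crossing $f$ of type $1$, an r-crossing for $f$ is a crossing $r$ such that, starting from $\infty$, one meets in this order: the under-cross of $f$, the over-cross of $r$, the over-cross of $f$, the under-cross of $r$. If $d$ is of type $0$, $W_2(p)=\sum w(f)w(r)$ over all pairs consisting of an f-crossing $f$ of $p$ and an r-crossing $r$ for $f$. If $p$ is of type $r_a$ or $l_c$ (then $hm$ is of type $1$), $W_1(p)=\sum w(r)$ over all r-crossings $r$ for $hm$. Crossings of the triangle ($d$, $hm$, $ml$) are included; all is computed in a small generic perturbation of $p$, and for positive triple crossings the result is the same for both perturbations. Positive triple crossings and smoothings. Braid words are read in the direction of the orientation, and positions are numbered so that in the positive crossing $\sigma_i$ the strand going from position $i$ to $i+1$ is the under strand. A triple crossing is positive if its three crossings are positive; then its perturbations are $\sigma_1\sigma_2\sigma_1$ and $\sigma_2\sigma_1\sigma_2$, and the Reidemeister move $\sigma_1\sigma_2\sigma_1\to\sigma_2\sigma_1\sigma_2$ has sign $+1$, its inverse sign $-1$. For a 3-braid $\beta$, $\beta(p)\in S(\partial T)$ is the element obtained by replacing the triple crossing by $\beta$. Quadruple crossings. A positive quadruple crossing is a point where four branches $1,2,3,4$ (from lowest to highest) meet in one point of the projection, pairwise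 transversally, forming a braid with all six crossings positive after perturbation. Its meridian $m$ is the loop of diagrams which is constant outside the quadruple crossing and which inside passes (up to far commutation) through the eight positive Reidemeister III moves given, with their signs, by $P_3:[121\to212]321\,(+)$, $P_4:21[232\to323]1\,(+)$, $\bar P_1:23[121\to212]3\,(+)$, $\bar P_2:[232\to323]123\,(+)$, $\bar P_3:321[323\to232]\,(-)$, $\bar P_4:3[212\to121]32\,(-)$, $P_1:1[323\to232]12\,(-)$, $P_2:123[212\to121]\,(-)$, where $i$ stands for $\sigma_i$. No assumption is made on the order in which the circle passes the four branches or on the position of $\infty$. *)

theory Defs
  imports Complex_Main "HOL-Library.Poly_Mapping" "HOL-Library.Product_Plus"
begin

section \<open>Oriented tangle diagrams\<close>

text \<open>
  A generic tangle diagram in the square is cut by horizontal lines, from top to bottom, into slices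
  that contain exactly one crossing or one extremum of the height function; every diagram has this
  form up to planar isotopy, and its boundary points then lie on the top and on the bottom edge.
  A strand end on a horizontal line is encoded by its orientation: \<^const>\<open>True\<close> means downwards.
  Positions are counted from the left, starting with 0.

  The slice \<open>(i, e)\<close> has its event \<open>e\<close> just to the right of the first \<open>i\<close> strands.
  In \<open>Cross True\<close> the over-strand runs from top right to bottom left, in
  \<open>Cross False\<close> from top left to bottom right. \<open>Birth b\<close> is a local maximum whose left leg has
  orientation \<open>b\<close>; \<open>Death\<close> is a local minimum.
\<close>

datatype event = Cross bool | Birth bool | Death

type_synonym slice = "nat \<times> event"

fun step :: "bool list \<Rightarrow> slice \<Rightarrow> bool list option" where
  "step w (i, Cross b) =
     (if i + 1 < length w then Some (w[i := w ! (i + 1), i + 1 := w ! i]) else None)"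
| "step w (i, Birth b) =
     (if i \<le> length w then Some (take i w @ [b, \<not> b] @ drop i w) else None)"
| "step w (i, Death) =
     (if i + 1 < length w \<and> w ! i \<noteq> w ! (i + 1) then Some (take i w @ drop (i + 2) w) else None)"

fun run :: "bool list \<Rightarrow> slice list \<Rightarrow> bool list option" where
  "run w [] = Some w"
| "run w (x # D) = Option.bind (step w x) (\<lambda>w'. run w' D)"

definition diagram :: "bool list \<Rightarrow> bool list \<Rightarrow> slice list \<Rightarrow> bool" where
  "diagram s t D \<longleftrightarrow> run s D = Some t"


section \<open>Regular isotopy\<close>

fun n_in :: "event \<Rightarrow> nat" where
  "n_in (Cross b) = 2"
| "n_in (Birth b) = 0"
| "n_in Death = 2"

fun n_out :: "event \<Rightarrow> nat" where
  "n_out (Cross b) = 2"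
| "n_out (Birth b) = 2"
| "n_out Death = 0"

text \<open>
  The first four kinds of moves generate planar isotopy. In the third Reidemeister move the condition
  excludes the two choices of crossings for which the three strands are not ordered by height.
  No first Reidemeister move is included.
\<close>

inductive local_move :: "slice list \<Rightarrow> slice list \<Rightarrow> bool" where
  far_commutation:
    "local_move [(i, e), (i + n_out e + k, f)] [(i + n_in e + k, f), (i, e)]"
| zigzag_left: "local_move [(i, Birth b), (i + 1, Death)] []"
| zigzag_right: "local_move [(i + 1, Birth b), (i, Death)] []"
| slide_birth:
    "local_move [(i + 1, Birth b), (i, Cross c)] [(i, Birth b), (i + 1, Cross (\<not> c))]"
| slide_death:
    "local_move [(i, Cross c), (i + 1, Death)] [(i + 1, Cross (\<not> c)), (i, Death)]"
| reidemeister2: "local_move [(i, Cross c), (i, Cross (\<not> c))] []"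
| reidemeister3:
    "\<not> (a = c \<and> b \<noteq> a) \<Longrightarrow>
     local_move [(i, Cross a), (i + 1, Cross b), (i, Cross c)]
                [(i + 1, Cross c), (i, Cross b), (i + 1, Cross a)]"


section \<open>The HOMFLYPT skein module\<close>

text \<open>
  The Laurent polynomial ring in \<open>v\<close> and \<open>z\<close> is the integral group ring of \<open>int \<times> int\<close>:
  the exponent pair \<open>(a, b)\<close> stands for the monomial with \<open>v\<close>-exponent \<open>a\<close> and \<open>z\<close>-exponent \<open>b\<close>.
\<close>

type_synonym laurent = "(int \<times> int) \<Rightarrow>\<^sub>0 int"

definition laurent_monom :: "int \<Rightarrow> int \<Rightarrow> laurent" where
  "laurent_monom a b = Poly_Mapping.single (a, b) 1"

abbreviation laurent_v :: laurent where "laurent_v \<equiv> laurent_monom 1 0"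
abbreviation laurent_v_inv :: laurent where "laurent_v_inv \<equiv> laurent_monom (-1) 0"
abbreviation laurent_z :: laurent where "laurent_z \<equiv> laurent_monom 0 1"
abbreviation laurent_z_inv :: laurent where "laurent_z_inv \<equiv> laurent_monom 0 (-1)"

definition laurent_delta :: laurent where
  "laurent_delta = (laurent_v - laurent_v_inv) * laurent_z_inv"

type_synonym chain = "slice list \<Rightarrow>\<^sub>0 laurent"

definition single_diagram :: "slice list \<Rightarrow> chain" where
  "single_diagram D = Poly_Mapping.single D 1"

definition chain_scale :: "laurent \<Rightarrow> chain \<Rightarrow> chain" where
  "chain_scale c x = Poly_Mapping.map ((*) c) x"

lemma lookup_chain_scale: "Poly_Mapping.lookup (chain_scale c x) D = c * Poly_Mapping.lookup x D"
  unfolding chain_scale_def by (simp add: Poly_Mapping.map.rep_eq when_def)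

interpretation chain: module chain_scale
  by unfold_locales
    (auto intro!: poly_mapping_eqI simp: lookup_chain_scale lookup_add algebra_simps)

text \<open>
  A crossing \<open>Cross c\<close> of two strands with top ends oriented \<open>x\<close> and \<open>y\<close> is positive iff
  \<open>c \<longleftrightarrow> x = y\<close>; if \<open>x \<noteq> y\<close>, its oriented smoothing consists of a minimum above a maximum.
  In both forms of a kink the two strands at the crossing point in the same vertical direction,
  so that the kink is positive iff \<open>c\<close>.
\<close>

definition smoothing :: "bool list \<Rightarrow> nat \<Rightarrow> slice list" where
  "smoothing w i =
     (if w ! i = w ! (i + 1) then [] else [(i, Death), (i, Birth (w ! (i + 1)))])"

inductive_set skein_relators :: "bool list \<Rightarrow> bool list \<Rightarrow> chain set"
  for s t :: "bool list" where
  regular_isotopy: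
    "\<lbrakk>local_move X Y; diagram s t (A @ X @ B); diagram s t (A @ Y @ B)\<rbrakk> \<Longrightarrow>
     single_diagram (A @ X @ B) - single_diagram (A @ Y @ B) \<in> skein_relators s t"
| skein:
    "\<lbrakk>diagram s w A; i + 1 < length w; diagram s t (A @ [(i, Cross True)] @ B);
      pos \<longleftrightarrow> w ! i = w ! (i + 1)\<rbrakk> \<Longrightarrow>
     single_diagram (A @ [(i, Cross pos)] @ B) - single_diagram (A @ [(i, Cross (\<not> pos))] @ B)
       - chain_scale laurent_z (single_diagram (A @ smoothing w i @ B)) \<in> skein_relators s t"
| kink_right:
    "diagram s t (A @ [(i + 1, Birth b), (i, Cross c), (i + 1, Death)] @ B) \<Longrightarrow>
     single_diagram (A @ [(i + 1, Birth b), (i, Cross c), (i + 1, Death)] @ B)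
       - chain_scale (if c then laurent_v else laurent_v_inv) (single_diagram (A @ B))
     \<in> skein_relators s t"
| kink_left:
    "diagram s t (A @ [(i, Birth b), (i + 1, Cross c), (i, Death)] @ B) \<Longrightarrow>
     single_diagram (A @ [(i, Birth b), (i + 1, Cross c), (i, Death)] @ B)
       - chain_scale (if c then laurent_v else laurent_v_inv) (single_diagram (A @ B))
     \<in> skein_relators s t"
| trivial_component:
    "diagram s t (A @ [(i, Birth b), (i, Death)] @ B) \<Longrightarrow>
     single_diagram (A @ [(i, Birth b), (i, Death)] @ B)
       - chain_scale laurent_delta (single_diagram (A @ B)) \<in> skein_relators s t"

text \<open>
  The skein module of the oriented boundary \<open>(s, t)\<close> consists of the classes of the linear
  combinations of diagrams with this boundary; a class is a coset of the span of the relators.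
\<close>

definition skein_class :: "bool list \<Rightarrow> bool list \<Rightarrow> chain \<Rightarrow> chain set" where
  "skein_class s t x = {y. y - x \<in> chain.span (skein_relators s t)}"


section \<open>The oriented circle and the order of its crossings\<close>

datatype bpoint = Top nat | Bot nat

definition entries :: "bool list \<Rightarrow> bool list \<Rightarrow> bpoint set" where
  "entries s t = {Top j |j. j < length s \<and> s ! j} \<union> {Bot j |j. j < length t \<and> \<not> t ! j}"

definition exits :: "bool list \<Rightarrow> bool list \<Rightarrow> bpoint set" where
  "exits s t = {Top j |j. j < length s \<and> \<not> s ! j} \<union> {Bot j |j. j < length t \<and> t ! j}"

definition abstract_closure :: "bool list \<Rightarrow> bool list \<Rightarrow> (bpoint \<Rightarrow> bpoint) \<Rightarrow> bool" where
  "abstract_closure s t \<sigma> \<longleftrightarrow> bij_betw \<sigma> (exits s t) (entries s t)"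

record based_diagram =
  source :: "bool list"
  slices :: "slice list"
  arcs :: "bpoint \<Rightarrow> bpoint"
  infty :: bpoint

text \<open>\<open>across x p\<close> is the other end of the strand of the single slice \<open>x\<close> that ends at \<open>p\<close>.\<close>

fun across :: "slice \<Rightarrow> bpoint \<Rightarrow> bpoint" where
  "across (i, Cross c) (Top j) = Bot (if j = i then i + 1 else if j = i + 1 then i else j)"
| "across (i, Cross c) (Bot j) = Top (if j = i then i + 1 else if j = i + 1 then i else j)"
| "across (i, Birth b) (Top j) = Bot (if j < i then j else j + 2)"
| "across (i, Birth b) (Bot j) =
     (if j = i then Bot (i + 1) else if j = i + 1 then Bot i
      else Top (if j < i then j else j - 2))"
| "across (i, Death) (Top j) =
     (if j = i then Top (i + 1) else if j = i + 1 then Top i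
      else Bot (if j < i then j else j - 2))"
| "across (i, Death) (Bot j) = Top (if j < i then j else j + 2)"

text \<open>The point \<open>(k, j)\<close> is the strand end at position \<open>j\<close> on the line above slice \<open>k\<close>.\<close>

definition level :: "based_diagram \<Rightarrow> nat \<Rightarrow> bool list" where
  "level E k = the (run (source E) (take k (slices E)))"

fun slice_point :: "nat \<Rightarrow> bpoint \<Rightarrow> nat \<times> nat" where
  "slice_point k (Top j) = (k, j)"
| "slice_point k (Bot j) = (k + 1, j)"

fun boundary_point :: "based_diagram \<Rightarrow> bpoint \<Rightarrow> nat \<times> nat" where
  "boundary_point E (Top j) = (0, j)"
| "boundary_point E (Bot j) = (length (slices E), j)"

fun next_point :: "based_diagram \<Rightarrow> nat \<times> nat \<Rightarrow> nat \<times> nat" where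
  "next_point E (k, j) =
     (if level E k ! j
      then (if k < length (slices E) then slice_point k (across (slices E ! k) (Top j))
            else boundary_point E (arcs E (Bot j)))
      else (if 0 < k then slice_point (k - 1) (across (slices E ! (k - 1)) (Bot j))
            else boundary_point E (arcs E (Top j))))"

definition one_circle :: "based_diagram \<Rightarrow> bool" where
  "one_circle E \<longleftrightarrow>
     (\<forall>k \<le> length (slices E). \<forall>j < length (level E k).
        \<exists>m. (next_point E ^^ m) (boundary_point E (infty E)) = (k, j))"

definition time :: "based_diagram \<Rightarrow> nat \<times> nat \<Rightarrow> nat" where
  "time E p = (LEAST m. (next_point E ^^ m) (boundary_point E (infty E)) = p)"

text \<open>
  An \<open>n\<close>-string link with an abstract closure to one oriented circle, on which the boundary point
  \<open>infty E\<close> is chosen. The last condition also excludes closed components of the tangle,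
  so that it consists of \<open>n\<close> arcs.
\<close>

definition closed_string_link :: "nat \<Rightarrow> bool list \<Rightarrow> based_diagram \<Rightarrow> bool" where
  "closed_string_link n t E \<longleftrightarrow>
     diagram (source E) t (slices E) \<and> length (source E) + length t = 2 * n \<and>
     abstract_closure (source E) t (arcs E) \<and>
     infty E \<in> entries (source E) t \<union> exits (source E) t \<and>
     one_circle E"


section \<open>Crossings and weights\<close>

text \<open>
  A crossing is given by the number of its slice. An over-cross or under-cross takes place at the
  time at which the circle arrives at the slice on the respective strand.
\<close>

definition crossings :: "based_diagram \<Rightarrow> nat set" where
  "crossings E = {k. k < length (slices E) \<and> (\<exists>i c. slices E ! k = (i, Cross c))}"

definition arrival :: "based_diagram \<Rightarrow> nat \<Rightarrow> nat \<Rightarrow> nat" where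
  "arrival E k j =
     time E (if level E k ! j then (k, j) else slice_point k (across (slices E ! k) (Top j)))"

definition over_time :: "based_diagram \<Rightarrow> nat \<Rightarrow> nat" where
  "over_time E k =
     (case slices E ! k of (i, e) \<Rightarrow> arrival E k (if e = Cross True then i + 1 else i))"

definition under_time :: "based_diagram \<Rightarrow> nat \<Rightarrow> nat" where
  "under_time E k =
     (case slices E ! k of (i, e) \<Rightarrow> arrival E k (if e = Cross True then i else i + 1))"

definition writhe :: "based_diagram \<Rightarrow> nat \<Rightarrow> int" where
  "writhe E k =
     (case slices E ! k of (i, e) \<Rightarrow>
        if (e = Cross True) = (level E k ! i = level E k ! (i + 1)) then 1 else -1)"

definition type_1 :: "based_diagram \<Rightarrow> nat \<Rightarrow> bool" where
  "type_1 E q \<longleftrightarrow> under_time E q < over_time E q"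

definition type_0 :: "based_diagram \<Rightarrow> nat \<Rightarrow> bool" where
  "type_0 E q \<longleftrightarrow> \<not> type_1 E q"

definition r_crossings :: "based_diagram \<Rightarrow> nat \<Rightarrow> nat set" where
  "r_crossings E f =
     {r \<in> crossings E. under_time E f < over_time E r \<and> over_time E r < over_time E f \<and>
        over_time E f < under_time E r}"

definition f_crossings :: "based_diagram \<Rightarrow> nat \<Rightarrow> nat set" where
  "f_crossings E d =
     {q \<in> crossings E. q \<noteq> d \<and> type_1 E q \<and> under_time E q < over_time E d}"

text \<open>
  A positive triple crossing is given by its perturbation \<open>\<sigma>\<^sub>1\<sigma>\<^sub>2\<sigma>\<^sub>1\<close>, whose crossings are the slices
  \<open>k\<close>, \<open>k + 1\<close>, \<open>k + 2\<close>. The low, mid and high branch are the strands that start in position 1, 2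
  and 3 of this braid, hence the three crossings are \<open>ml\<close>, \<open>d\<close> and \<open>hm\<close> in this order.
\<close>

definition crossing_ml :: "nat \<Rightarrow> nat" where "crossing_ml k = k"
definition crossing_d :: "nat \<Rightarrow> nat" where "crossing_d k = k + 1"
definition crossing_hm :: "nat \<Rightarrow> nat" where "crossing_hm k = k + 2"

definition low_time :: "based_diagram \<Rightarrow> nat \<Rightarrow> nat" where
  "low_time E k = under_time E (crossing_d k)"
definition mid_time :: "based_diagram \<Rightarrow> nat \<Rightarrow> nat" where
  "mid_time E k = over_time E (crossing_ml k)"
definition high_time :: "based_diagram \<Rightarrow> nat \<Rightarrow> nat" where
  "high_time E k = over_time E (crossing_d k)"

definition global_type_ra :: "based_diagram \<Rightarrow> nat \<Rightarrow> bool" where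
  "global_type_ra E k \<longleftrightarrow> mid_time E k < high_time E k \<and> high_time E k < low_time E k"

definition global_type_lc :: "based_diagram \<Rightarrow> nat \<Rightarrow> bool" where
  "global_type_lc E k \<longleftrightarrow> mid_time E k < low_time E k \<and> low_time E k < high_time E k"

definition W1 :: "based_diagram \<Rightarrow> nat \<Rightarrow> int" where
  "W1 E k = (\<Sum>r\<in>r_crossings E (crossing_hm k). writhe E r)"

definition W2 :: "based_diagram \<Rightarrow> nat \<Rightarrow> int" where
  "W2 E k = (\<Sum>f\<in>f_crossings E (crossing_d k). \<Sum>r\<in>r_crossings E f. writhe E f * writhe E r)"


section \<open>The meridian of a positive quadruple crossing\<close>

text \<open>
  The four branches of the quadruple crossing run downwards and leave \<open>a\<close> strands to their left;
  the rest of the diagram is \<open>A\<close> above and \<open>B\<close> below. Braid words are hence read from top to bottom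
  and positions are numbered from left to right. Between downward strands \<open>Cross True\<close> is positive,
  and its under-strand moves to the right.
\<close>

definition insert_braid ::
  "slice list \<Rightarrow> nat \<Rightarrow> slice list \<Rightarrow> nat list \<Rightarrow> slice list" where
  "insert_braid A a B \<beta> = A @ map (\<lambda>i. (a + (i - 1), Cross True)) \<beta> @ B"

text \<open>
  \<open>Triple \<alpha> h \<gamma> \<epsilon>\<close> is the triple crossing between the braids \<open>\<alpha>\<close> and \<open>\<gamma>\<close> on the strands
  \<open>h + 1\<close>, \<open>h + 2\<close>, \<open>h + 3\<close>, passed with the sign \<open>\<epsilon>\<close>.
\<close>

datatype triple =
  Triple (before: "nat list") (shift: nat) (after: "nat list") (sign_of: int)

definition meridian :: "triple list" where
  "meridian =
    [Triple [] 0 [3, 2, 1] 1,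
     Triple [2, 1] 1 [1] 1,
     Triple [2, 3] 0 [3] 1,
     Triple [] 1 [1, 2, 3] 1,
     Triple [3, 2, 1] 1 [] (-1),
     Triple [3] 0 [3, 2] (-1),
     Triple [1] 1 [1, 2] (-1),
     Triple [1, 2, 3] 0 [] (-1)]"

definition replace_triple :: "triple \<Rightarrow> nat list \<Rightarrow> nat list" where
  "replace_triple p \<beta> = before p @ map (\<lambda>i. i + shift p) \<beta> @ after p"

text \<open>
  Given the source, the two outer parts, the closing arcs and the point at infinity:
  \<open>perturbed\<close> is the closed diagram next to the triple crossing \<open>p\<close>, \<open>triangle\<close> is the first
  slice of its triangle, and \<open>smoothed\<close> is the element obtained by replacing \<open>p\<close> by a 3-braid.
\<close>

definition perturbed ::
  "bool list \<Rightarrow> slice list \<Rightarrow> nat \<Rightarrow> slice list \<Rightarrow> (bpoint \<Rightarrow> bpoint) \<Rightarrow> bpoint \<Rightarrow> triple \<Rightarrow>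
   based_diagram" where
  "perturbed s A a B \<sigma> x p =
     \<lparr>source = s, slices = insert_braid A a B (replace_triple p [1, 2, 1]), arcs = \<sigma>, infty = x\<rparr>"

definition triangle :: "slice list \<Rightarrow> triple \<Rightarrow> nat" where
  "triangle A p = length A + length (before p)"

definition smoothed :: "slice list \<Rightarrow> nat \<Rightarrow> slice list \<Rightarrow> triple \<Rightarrow> nat list \<Rightarrow> chain" where
  "smoothed A a B p \<beta> = single_diagram (insert_braid A a B (replace_triple p \<beta>))"

definition R1_meridian ::
  "bool list \<Rightarrow> slice list \<Rightarrow> nat \<Rightarrow> slice list \<Rightarrow> (bpoint \<Rightarrow> bpoint) \<Rightarrow> bpoint \<Rightarrow> chain" where
  "R1_meridian s A a B \<sigma> x =
     (let E = perturbed s A a B \<sigma> x; k = triangle A in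
       (\<Sum>p\<leftarrow>filter (\<lambda>p. global_type_lc (E p) (k p) \<or> global_type_ra (E p) (k p)) meridian.
          chain_scale (of_int (sign_of p * W1 (E p) (k p))) (smoothed A a B p [2, 1]))
     + (\<Sum>p\<leftarrow>filter (\<lambda>p. type_0 (E p) (crossing_d (k p))) meridian.
          chain_scale (of_int (sign_of p) * laurent_z * of_int (W2 (E p) (k p)))
            (smoothed A a B p [2] - smoothed A a B p [1])))"

end

theory Submission
  imports Defs "HOL-Combinatorics.Transposition"
begin

text \<open>
  The eight diagrams next to the triple crossings differ only in the word for the half twist on four
  strands. Permuting the strand ends on the lines of the half twist conjugates the successor
  function of one closed diagram into that of another, so crossings outside have the same times in
  all eight diagrams, and each branch passes its six slices consecutively. The weights hence depend
  only on the order in which the circle meets the four branches and on unknown contributions of the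
  outside that are the same for all diagrams. Checking the 24 orders gives linear relations:
  writing \<open>\<alpha>\<close> and \<open>\<beta>\<close> for \<open>W\<^sub>1\<close> and \<open>W\<^sub>2\<close>, cut off to the triple crossings that occur in the
  respective sum, \<open>\<alpha>(P\<^sub>2) = \<alpha>(P\<^sub>2')\<close>, \<open>\<alpha>(P\<^sub>1) = \<alpha>(P\<^sub>1')\<close>,
  \<open>\<alpha>(P\<^sub>3) + \<alpha>(P\<^sub>4) = \<alpha>(P\<^sub>3') + \<alpha>(P\<^sub>4')\<close>, \<open>\<alpha>(P\<^sub>1') + \<beta>(P\<^sub>3) = \<beta>(P\<^sub>3')\<close>,
  \<open>\<beta>(P\<^sub>4) = \<beta>(P\<^sub>1') = \<beta>(P\<^sub>4') = \<beta>(P\<^sub>1)\<close> and \<open>\<beta>(P\<^sub>2) = \<beta>(P\<^sub>2')\<close>, where the dash stands for the bar.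
  With these the sum becomes a combination of relations of the Hecke algebra.
\<close>

section \<open>Permutations underlying braid words\<close>

text \<open>The permutation underlying a braid word: the strand that starts in position
  \<open>j\<close>, counted from 0, ends in position \<open>place w j\<close>. The letter
  \<open>i\<close> exchanges positions \<open>i - 1\<close> and \<open>i\<close>.\<close>

definition place :: "nat list \<Rightarrow> nat \<Rightarrow> nat" where
  "place w = fold (\<lambda>i. transpose (i - 1) i) w"

lemma place_Nil [simp]: "place [] = id"
  by (simp add: place_def)

lemma place_Cons: "place (i # w) = place w \<circ> transpose (i - 1) i"
  by (simp add: place_def)

lemma place_append: "place (u @ w) = place w \<circ> place u"
  by (simp add: place_def)

lemma place_rev: "place (rev w) (place w j) = j"
  by (induction w arbitrary: j) (simp_all add: place_Cons place_append)

lemma place_rev': "place w (place (rev w) j) = j"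
  using place_rev[of "rev w"] by simp

lemma inj_place: "inj (place w)"
  by (metis injI place_rev)

lemma place_ge:
  assumes "set w \<subseteq> {1, 2, 3}" and "j \<ge> 4"
  shows "place w j = j"
  using assms by (induction w) (auto simp: place_Cons transpose_def)

lemma place_less_iff:
  assumes "set w \<subseteq> {1, 2, 3}"
  shows "place w j < 4 \<longleftrightarrow> j < 4"
proof -
  have "place w j < 4" if "j < 4" "set w \<subseteq> {1, 2, 3}" for w j
    using that by (induction w arbitrary: j) (auto simp: place_Cons transpose_def)
  then show ?thesis
    using assms place_ge[OF assms, of j] by (cases "j < 4") auto
qed

definition beside :: "nat \<Rightarrow> (nat \<Rightarrow> nat) \<Rightarrow> nat \<Rightarrow> nat" where
  "beside a f j = (if j < a then j else a + f (j - a))"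

lemma beside_id [simp]: "beside a id j = j" and beside_ident [simp]: "beside a (\<lambda>i. i) j = j"
  by (auto simp: beside_def)

lemma beside_comp: "beside a f (beside a g j) = beside a (f \<circ> g) j"
  by (auto simp: beside_def)

lemma beside_add [simp]: "beside a f (a + b) = a + f b"
  by (simp add: beside_def)

lemma inj_beside:
  assumes "inj f"
  shows "inj (beside a f)"
proof (rule injI)
  fix j k
  assume "beside a f j = beside a f k"
  then have "j < a \<and> j = k \<or> a \<le> j \<and> a \<le> k \<and> f (j - a) = f (k - a)"
    by (auto simp: beside_def split: if_splits)
  then show "j = k"
    by (metis assms eq_diff_iff injD)
qed

abbreviation braid_slice :: "nat \<Rightarrow> nat \<Rightarrow> slice" where
  "braid_slice a i \<equiv> (a + (i - 1), Cross True)"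

lemma across_braid_slice:
  assumes "i \<ge> 1"
  shows "across (braid_slice a i) (Top j) = Bot (beside a (transpose (i - 1) i) j)"
    and "across (braid_slice a i) (Bot j) = Top (beside a (transpose (i - 1) i) j)"
  using assms by (auto simp: beside_def transpose_def)

lemma run_append: "run w (D @ D') = Option.bind (run w D) (\<lambda>w'. run w' D')"
  by (induction D arbitrary: w) (auto split: bind_split)

section \<open>Crossings of a half twist and the finite model of the weights\<close>

text \<open>Branches are named by their position 0 to 3 above the half twist; the first
  \<open>m\<close> letters read backwards lead from a crossing up to that line. As the strand that
  moves right goes underneath, this numbering also orders the branches of a half twist by height, 0
  being the lowest.\<close>

definition under_branch :: "nat list \<Rightarrow> nat \<Rightarrow> nat" where
  "under_branch w m = place (rev (take m w)) (w ! m - 1)"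

definition over_branch :: "nat list \<Rightarrow> nat \<Rightarrow> nat" where
  "over_branch w m = place (rev (take m w)) (w ! m)"

definition passages :: "nat list \<Rightarrow> (nat \<times> nat \<times> nat) list" where
  "passages w = map (\<lambda>m. (m, under_branch w m, over_branch w m)) [0..<6]"

lemma nth_passages: "m < 6 \<Longrightarrow> passages w ! m = (m, under_branch w m, over_branch w m)"
  by (simp add: passages_def)

lemma sum_passages:
  "(\<Sum>(l, u, v)\<leftarrow>passages w. g l u v) = (\<Sum>l<6. g l (under_branch w l) (over_branch w l))"
  by (simp add: passages_def comp_def interv_sum_list_conv_sum_set_nat atLeast0LessThan)

text \<open>In each of the eight words every pair of branches crosses once, the smaller number
  underneath. Only the order of the crossings along the branches differs.\<close>

lemma meridian_passages:
  "passages [1, 2, 1, 3, 2, 1] = [(0, 0, 1), (1, 0, 2), (2, 1, 2), (3, 0, 3), (4, 1, 3), (5, 2, 3)]"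
  "passages [2, 1, 2, 3, 2, 1] = [(0, 1, 2), (1, 0, 2), (2, 0, 1), (3, 0, 3), (4, 1, 3), (5, 2, 3)]"
  "passages [2, 3, 1, 2, 1, 3] = [(0, 1, 2), (1, 1, 3), (2, 0, 2), (3, 0, 3), (4, 2, 3), (5, 0, 1)]"
  "passages [2, 3, 2, 1, 2, 3] = [(0, 1, 2), (1, 1, 3), (2, 2, 3), (3, 0, 3), (4, 0, 2), (5, 0, 1)]"
  "passages [3, 2, 1, 2, 3, 2] = [(0, 2, 3), (1, 1, 3), (2, 0, 3), (3, 0, 1), (4, 0, 2), (5, 1, 2)]"
  "passages [3, 1, 2, 1, 3, 2] = [(0, 2, 3), (1, 0, 1), (2, 0, 3), (3, 1, 3), (4, 0, 2), (5, 1, 2)]"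
  "passages [1, 2, 3, 2, 1, 2] = [(0, 0, 1), (1, 0, 2), (2, 0, 3), (3, 2, 3), (4, 1, 3), (5, 1, 2)]"
  "passages [1, 2, 3, 1, 2, 1] = [(0, 0, 1), (1, 0, 2), (2, 0, 3), (3, 1, 2), (4, 1, 3), (5, 2, 3)]"
  by (simp_all add: passages_def under_branch_def over_branch_def place_def transpose_def upt_rec)

text \<open>
  In the following model the relation \<open>L\<close> is the order in which the circle meets the four branches,
  while \<open>X\<close> and \<open>G\<close> collect the contributions of the crossings in the rest of the diagram.
\<close>

fun earlier :: "(nat \<Rightarrow> nat \<Rightarrow> bool) \<Rightarrow> nat \<times> nat \<Rightarrow> nat \<times> nat \<Rightarrow> bool" where
  "earlier L (b, l) (c, m) = (if b = c then l < m else L b c)"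

fun model_r ::
  "(nat \<Rightarrow> nat \<Rightarrow> bool) \<Rightarrow> (nat \<Rightarrow> nat \<Rightarrow> int) \<Rightarrow> (nat \<times> nat \<times> nat) list \<Rightarrow> nat \<times> nat \<times> nat \<Rightarrow> int"
where
  "model_r L X cs (m, u, v) = X u v +
     (\<Sum>(l, u', v')\<leftarrow>cs. of_bool (earlier L (u, m) (v', l) \<and> earlier L (v', l) (v, m) \<and>
        earlier L (v, m) (u', l)))"

text \<open>The letters \<open>h\<close>, \<open>h + 1\<close>, \<open>h + 2\<close> of a triangle
  are \<open>ml\<close>, \<open>d\<close> and \<open>hm\<close>, hence the middle branch is the
  over-strand at the first of them. The value is 0 for global types other than \<open>l_c\<close>
  and \<open>r_a\<close>, so that sums can run over the whole meridian.\<close>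

definition model_W1 ::
  "(nat \<Rightarrow> nat \<Rightarrow> bool) \<Rightarrow> (nat \<Rightarrow> nat \<Rightarrow> int) \<Rightarrow> (nat \<times> nat \<times> nat) list \<Rightarrow> nat \<Rightarrow> int"
where
  "model_W1 L X cs h =
     (let (_, low, high) = cs ! (h + 1); (_, _, mid) = cs ! h
      in if L mid low \<and> L low high \<or> L mid high \<and> L high low
         then model_r L X cs (cs ! (h + 2)) else 0)"

text \<open>The f-crossings outside are summed up in \<open>G high\<close>, those in the half twist
  are listed. The latter have writhe 1, so no factor \<open>w(f)\<close> appears for them. The value
  is 0 unless \<open>d\<close> is of type 0.\<close>

definition model_W2 ::
  "(nat \<Rightarrow> nat \<Rightarrow> bool) \<Rightarrow> (nat \<Rightarrow> nat \<Rightarrow> int) \<Rightarrow> (nat \<Rightarrow> int) \<Rightarrow>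
   (nat \<times> nat \<times> nat) list \<Rightarrow> nat \<Rightarrow> int"
where
  "model_W2 L X G cs h =
     (let (d, low, high) = cs ! (h + 1)
      in of_bool (L high low) * (G high +
        (\<Sum>(m, u, v)\<leftarrow>cs. of_bool (m \<noteq> d \<and> earlier L (u, m) (v, m) \<and> earlier L (u, m) (high, d))
            * model_r L X cs (m, u, v))))"

section \<open>Linear relations between the model weights\<close>

locale branch_order =
  fixes L :: "nat \<Rightarrow> nat \<Rightarrow> bool"
  assumes total: "b < 4 \<Longrightarrow> c < 4 \<Longrightarrow> b \<noteq> c \<Longrightarrow> L b c \<longleftrightarrow> \<not> L c b"
    and trans: "L b c \<Longrightarrow> L c d \<Longrightarrow> L b d"
begin

lemma swap:
  "L 1 0 \<longleftrightarrow> \<not> L 0 1" "L 2 0 \<longleftrightarrow> \<not> L 0 2" "L 3 0 \<longleftrightarrow> \<not> L 0 3"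
  "L 2 1 \<longleftrightarrow> \<not> L 1 2" "L 3 1 \<longleftrightarrow> \<not> L 1 3" "L 3 2 \<longleftrightarrow> \<not> L 2 3"
  by (rule total; simp)+

lemma swap_Suc:
  "L (Suc 0) 0 \<longleftrightarrow> \<not> L 0 (Suc 0)" "L 2 (Suc 0) \<longleftrightarrow> \<not> L (Suc 0) 2" "L 3 (Suc 0) \<longleftrightarrow> \<not> L (Suc 0) 3"
  using swap by simp_all

text \<open>Transitivity in terms of the six values \<open>L b c\<close> with \<open>b < c\<close>:
  for each triple of branches exactly the two cyclic assignments are excluded, which leaves 24 of
  the 64 assignments.\<close>

lemma transitive:
  "(L 0 1 \<and> L 1 2 \<longrightarrow> L 0 2) \<and> (L 0 2 \<longrightarrow> L 0 1 \<or> L 1 2)"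
  "(L 0 1 \<and> L 1 3 \<longrightarrow> L 0 3) \<and> (L 0 3 \<longrightarrow> L 0 1 \<or> L 1 3)"
  "(L 0 2 \<and> L 2 3 \<longrightarrow> L 0 3) \<and> (L 0 3 \<longrightarrow> L 0 2 \<or> L 2 3)"
  "(L 1 2 \<and> L 2 3 \<longrightarrow> L 1 3) \<and> (L 1 3 \<longrightarrow> L 1 2 \<or> L 2 3)"
  using trans swap by blast+

lemmas model_simps = model_W1_def model_W2_def swap swap_Suc

text \<open>This and the following relations are checked by distinguishing the six truth values that
  remain after \<open>swap\<close>. Assignments that are no orders contradict
  \<open>transitive\<close>; in the others both sides agree for arbitrary \<open>X\<close> and
  \<open>G\<close>.\<close>

lemma W1_P2:
  "model_W1 L X (passages [2, 3, 2, 1, 2, 3]) 0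
   = model_W1 L X (passages [1, 2, 3, 1, 2, 1]) 3"
  using transitive unfolding meridian_passages
  by (simp add: model_simps; cases "L 0 (Suc 0)"; cases "L 0 2"; cases "L 0 3";
      cases "L (Suc 0) 2"; cases "L (Suc 0) 3"; cases "L 2 3"; simp)

lemma W2_P2:
  "model_W2 L X G (passages [2, 3, 2, 1, 2, 3]) 0
   = model_W2 L X G (passages [1, 2, 3, 1, 2, 1]) 3"
  using transitive unfolding meridian_passages
  by (simp add: model_simps; cases "L 0 (Suc 0)"; cases "L 0 2"; cases "L 0 3";
      cases "L (Suc 0) 2"; cases "L (Suc 0) 3"; cases "L 2 3"; simp)

lemma W1_P1:
  "model_W1 L X (passages [2, 3, 1, 2, 1, 3]) 2
   = model_W1 L X (passages [1, 2, 3, 2, 1, 2]) 1"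
  using transitive unfolding meridian_passages
  by (simp add: model_simps; cases "L 0 (Suc 0)"; cases "L 0 2"; cases "L 0 3";
      cases "L (Suc 0) 2"; cases "L (Suc 0) 3"; cases "L 2 3"; simp)

text \<open>In \<open>P\<^sub>3\<close> and \<open>P\<^sub>3'\<close> the crossing \<open>d\<close>
  joins branches 0 and 2. Branch 2 passes under branch 3 after \<open>d\<close> in the first diagram
  and before \<open>d\<close> in the second, so there the crossing of 2 and 3 becomes an additional
  f-crossing if 2 comes before 0 and before 3. This is the condition for \<open>P\<^sub>1'\<close>
  to be of type \<open>r_a\<close> or \<open>l_c\<close>, and this crossing is its
  \<open>hm\<close>. The remaining differences inside the half twist balance.\<close>

lemma W1_P1_W2:
  "model_W1 L X (passages [2, 3, 1, 2, 1, 3]) 2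
   + model_W2 L X G (passages [1, 2, 1, 3, 2, 1]) 0
   = model_W2 L X G (passages [3, 2, 1, 2, 3, 2]) 3"
  using transitive unfolding meridian_passages
  by (simp add: model_simps; cases "L 0 (Suc 0)"; cases "L 0 2"; cases "L 0 3";
      cases "L (Suc 0) 2"; cases "L (Suc 0) 3"; cases "L 2 3"; simp)

text \<open>In \<open>P\<^sub>4\<close>, \<open>P\<^sub>4'\<close>, \<open>P\<^sub>1\<close> and
  \<open>P\<^sub>1'\<close> alike, \<open>d\<close> joins branches 0 and 3. Branch 3 is never
  underneath in the half twist, so \<open>L\<close> alone decides which pairs of branches form
  f-crossings; only the sums of their weights remain to be compared.\<close>

lemma W2_P4_P1:
  "model_W2 L X G (passages [2, 1, 2, 3, 2, 1]) 2
   = model_W2 L X G (passages [2, 3, 1, 2, 1, 3]) 2"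
  using transitive unfolding meridian_passages
  by (simp add: model_simps; cases "L 0 (Suc 0)"; cases "L 0 2"; cases "L 0 3";
      cases "L (Suc 0) 2"; cases "L (Suc 0) 3"; cases "L 2 3"; simp)

lemma W2_P4:
  "model_W2 L X G (passages [2, 1, 2, 3, 2, 1]) 2
   = model_W2 L X G (passages [3, 1, 2, 1, 3, 2]) 1"
  using transitive unfolding meridian_passages
  by (simp add: model_simps; cases "L 0 (Suc 0)"; cases "L 0 2"; cases "L 0 3";
      cases "L (Suc 0) 2"; cases "L (Suc 0) 3"; cases "L 2 3"; simp)

lemma W2_P1:
  "model_W2 L X G (passages [2, 3, 1, 2, 1, 3]) 2
   = model_W2 L X G (passages [1, 2, 3, 2, 1, 2]) 1"
  using transitive unfolding meridian_passages
  by (simp add: model_simps; cases "L 0 (Suc 0)"; cases "L 0 2"; cases "L 0 3";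
      cases "L (Suc 0) 2"; cases "L (Suc 0) 3"; cases "L 2 3"; simp)

text \<open>If 1 comes before 0 and the order is 1, 3, 2, the crossing of branches 2 and 3 is an
  r-crossing for \<open>hm\<close> in \<open>P\<^sub>3\<close> but not in \<open>P\<^sub>3'\<close>,
  and in \<open>P\<^sub>4'\<close> but not in \<open>P\<^sub>4\<close>. Hence only the sums agree.
  The relation is solved for \<open>P\<^sub>4'\<close> in order to serve as a rewrite rule.\<close>

lemma W1_P3_P4:
  "model_W1 L X (passages [3, 1, 2, 1, 3, 2]) 1
   = model_W1 L X (passages [1, 2, 1, 3, 2, 1]) 0
   + model_W1 L X (passages [2, 1, 2, 3, 2, 1]) 2
   - model_W1 L X (passages [3, 2, 1, 2, 3, 2]) 3"
  using transitive unfolding meridian_passages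
  by (simp add: model_simps; cases "L 0 (Suc 0)"; cases "L 0 2"; cases "L 0 3";
      cases "L (Suc 0) 2"; cases "L (Suc 0) 3"; cases "L 2 3"; simp)

end

section \<open>Half twists on four strands\<close>

text \<open>The word next to \<open>P\<^sub>3\<close>, for which the closure to one circle is
  assumed; it is the reference for the other seven.\<close>

definition standard_word :: "nat list" where
  "standard_word = [1, 2, 1, 3, 2, 1]"

definition crossing_pairs :: "(nat \<times> nat) set" where
  "crossing_pairs = {(0, 1), (0, 2), (0, 3), (1, 2), (1, 3), (2, 3)}"

text \<open>What the comparison of the closed diagrams requires of the eight words. The last two
  conditions express that each pair of branches crosses exactly once, the lower one
  underneath.\<close>

definition half_twist :: "nat list \<Rightarrow> bool" where
  "half_twist w \<longleftrightarrow> length w = 6 \<and> set w \<subseteq> {1, 2, 3} \<and> place w = place standard_word \<and>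
     distinct (map snd (passages w)) \<and> set (map snd (passages w)) = crossing_pairs"

text \<open>A sum that ignores at which letter two branches cross is the same for all half twists.
  This makes \<open>G\<close> common to the eight diagrams.\<close>

lemma sum_crossing_pairs:
  fixes g :: "nat \<Rightarrow> nat \<Rightarrow> int"
  assumes "half_twist w"
  shows "(\<Sum>l<6. g (under_branch w l) (over_branch w l)) = (\<Sum>(u, v)\<in>crossing_pairs. g u v)"
proof -
  have "(\<Sum>l<6. g (under_branch w l) (over_branch w l))
      = sum_list (map (\<lambda>(u, v). g u v) (map snd (passages w)))"
    using sum_passages[of "\<lambda>_. g" w] by (simp add: comp_def case_prod_unfold)
  also have "\<dots> = (\<Sum>(u, v)\<in>crossing_pairs. g u v)"
    using assms unfolding half_twist_def by (metis sum_list_distinct_conv_sum_set)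
  finally show ?thesis .
qed

lemma place_half_twist:
  "place [1, 2, 1, 3, 2, 1] j = (if j < 4 then 3 - j else j)"
  "place [2, 1, 2, 3, 2, 1] j = (if j < 4 then 3 - j else j)"
  "place [2, 3, 1, 2, 1, 3] j = (if j < 4 then 3 - j else j)"
  "place [2, 3, 2, 1, 2, 3] j = (if j < 4 then 3 - j else j)"
  "place [3, 2, 1, 2, 3, 2] j = (if j < 4 then 3 - j else j)"
  "place [3, 1, 2, 1, 3, 2] j = (if j < 4 then 3 - j else j)"
  "place [1, 2, 3, 2, 1, 2] j = (if j < 4 then 3 - j else j)"
  "place [1, 2, 3, 1, 2, 1] j = (if j < 4 then 3 - j else j)"
proof -
  consider "j = 0" | "j = 1" | "j = 2" | "j = 3" | "j \<ge> 4"
    by linarith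
  then show
    "place [1, 2, 1, 3, 2, 1] j = (if j < 4 then 3 - j else j)"
    "place [2, 1, 2, 3, 2, 1] j = (if j < 4 then 3 - j else j)"
    "place [2, 3, 1, 2, 1, 3] j = (if j < 4 then 3 - j else j)"
    "place [2, 3, 2, 1, 2, 3] j = (if j < 4 then 3 - j else j)"
    "place [3, 2, 1, 2, 3, 2] j = (if j < 4 then 3 - j else j)"
    "place [3, 1, 2, 1, 3, 2] j = (if j < 4 then 3 - j else j)"
    "place [1, 2, 3, 2, 1, 2] j = (if j < 4 then 3 - j else j)"
    "place [1, 2, 3, 1, 2, 1] j = (if j < 4 then 3 - j else j)"
    by (cases; simp add: place_def transpose_def)+
qed

lemma meridian_half_twist:
  "half_twist [1, 2, 1, 3, 2, 1]" "half_twist [2, 1, 2, 3, 2, 1]"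
  "half_twist [2, 3, 1, 2, 1, 3]" "half_twist [2, 3, 2, 1, 2, 3]"
  "half_twist [3, 2, 1, 2, 3, 2]" "half_twist [3, 1, 2, 1, 3, 2]"
  "half_twist [1, 2, 3, 2, 1, 2]" "half_twist [1, 2, 3, 1, 2, 1]"
  unfolding half_twist_def standard_word_def meridian_passages fun_eq_iff place_half_twist crossing_pairs_def
  by auto

lemma half_twist_standard: "half_twist standard_word"
  unfolding standard_word_def by (rule meridian_half_twist(1))

section \<open>Comparison of the closed diagrams with the reference diagram\<close>

locale quadruple_crossing =
  fixes n :: nat
    and s t left right :: "bool list"
    and A B :: "slice list"
    and \<sigma> :: "bpoint \<Rightarrow> bpoint"
    and x :: bpoint
  assumes diagram_above: "diagram s (left @ [True, True, True, True] @ right) A"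
    and diagram_below: "diagram (left @ [True, True, True, True] @ right) t B"
    and closed: "closed_string_link n t
           \<lparr>source = s, slices = insert_braid A (length left) B [1, 2, 1, 3, 2, 1],
            arcs = \<sigma>, infty = x\<rparr>"
begin

abbreviation a :: nat where "a \<equiv> length left"
abbreviation N :: nat where "N \<equiv> length A"
abbreviation middle :: "bool list" where "middle \<equiv> left @ [True, True, True, True] @ right"

definition braided :: "nat list \<Rightarrow> based_diagram" where
  "braided w = \<lparr>source = s, slices = insert_braid A a B w, arcs = \<sigma>, infty = x\<rparr>"

abbreviation w0 :: "nat list" where "w0 \<equiv> standard_word"

lemma braided_simps [simp]:
  "source (braided w) = s" "slices (braided w) = insert_braid A a B w"
  "arcs (braided w) = \<sigma>" "infty (braided w) = x"
  by (simp_all add: braided_def)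

lemma middle_nth: "c < 4 \<Longrightarrow> middle ! (a + c)"
  by (auto simp: nth_append less_Suc_eq numeral_eq_Suc)

lemma step_middle: "i \<in> {1, 2, 3} \<Longrightarrow> step middle (braid_slice a i) = Some middle"
  by (auto simp: list_update_append nth_append)

lemma run_middle: "set w \<subseteq> {1, 2, 3} \<Longrightarrow> run middle (map (braid_slice a) w) = Some middle"
proof (induction w)
  case (Cons i w)
  then have "i \<in> {1, 2, 3}" "run middle (map (braid_slice a) w) = Some middle"
    by auto
  then show ?case
    by (simp only: list.map run.simps step_middle bind.simps)
qed simp

text \<open>Crossings of downward strands leave the orientations unchanged, so all lines of the half
  twist carry \<open>middle\<close>.\<close>

lemma run_insert_braid:
  assumes "set w \<subseteq> {1, 2, 3}"
  shows "run s (take k (insert_braid A a B w)) =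
    (if k \<le> N then run s (take k A) else if k \<le> N + length w then Some middle
     else run middle (take (k - N - length w) B))"
proof -
  have A: "run s A = Some middle"
    using diagram_above by (simp add: diagram_def)
  have "set (take m w) \<subseteq> {1, 2, 3}" for m
    using assms set_take_subset by fast
  then show ?thesis
    using run_middle[OF assms] run_middle[of "take (k - N) w"]
    by (auto simp: insert_braid_def run_append A take_map simp del: append.simps append_assoc)
qed

lemma level_braided:
  assumes "half_twist w"
  shows "level (braided w) k =
    (if k \<le> N then the (run s (take k A)) else if k \<le> N + 6 then middle
     else the (run middle (take (k - N - 6) B)))"
  using assms by (simp add: level_def half_twist_def run_insert_braid del: append.simps append_assoc)

lemma level_middle:
  assumes "half_twist w" "N \<le> k" "k \<le> N + 6"
  shows "level (braided w) k = middle"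
  using assms diagram_above by (auto simp: level_braided diagram_def)

lemma level_eq: "half_twist w \<Longrightarrow> level (braided w) k = level (braided w0) k"
  by (simp only: level_braided half_twist_standard)

lemma slices_middle:
  assumes "half_twist w" "m < 6"
  shows "insert_braid A a B w ! (N + m) = braid_slice a (w ! m)" and "w ! m \<in> {1, 2, 3}"
  using assms nth_mem[of m w] unfolding insert_braid_def half_twist_def
  by (auto simp: nth_append simp del: nth_mem)

lemma slices_outside:
  assumes "half_twist w" "k < N \<or> N + 6 \<le> k"
  shows "insert_braid A a B w ! k = insert_braid A a B w0 ! k"
proof (cases "k < N")
  case False
  then obtain j where k: "k = N + (6 + j)"
    using assms(2) by (metis add.assoc le_iff_add)
  have "insert_braid A a B v ! k = B ! j" if "half_twist v" for v
  proof -
    have "length (map (braid_slice a) v) = 6"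
      using that by (simp add: half_twist_def)
    then show ?thesis
      unfolding insert_braid_def k by (metis nth_append_length_plus)
  qed
  then show ?thesis
    using assms(1) half_twist_standard by simp
qed (simp add: insert_braid_def nth_append)

lemma length_slices:
  "half_twist w \<Longrightarrow> length (insert_braid A a B w) = N + 6 + length B"
  by (auto simp: insert_braid_def half_twist_def)

text \<open>Matches the positions on the line \<open>m\<close> of the half twist: a position is
  followed back to the top in the reference diagram and then down the same branch in the diagram of
  \<open>w\<close>.\<close>

definition shuffle :: "nat list \<Rightarrow> nat \<Rightarrow> nat \<Rightarrow> nat" where
  "shuffle w m = place (take m w) \<circ> place (rev (take m w0))"

definition transfer :: "nat list \<Rightarrow> nat \<times> nat \<Rightarrow> nat \<times> nat" where
  "transfer w = (\<lambda>(k, j).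
     (k, if N \<le> k \<and> k \<le> N + 6 then beside a (shuffle w (k - N)) j else j))"

lemma shuffle_0 [simp]: "shuffle w 0 = id"
  by (simp add: shuffle_def)

text \<open>Both words induce the same permutation. Hence \<open>transfer\<close> fits together with
  the identity below the half twist.\<close>

lemma shuffle_6:
  assumes "half_twist w"
  shows "shuffle w 6 = id"
proof -
  have "take 6 w = w" "take 6 w0 = w0"
    using assms half_twist_standard by (simp_all add: half_twist_def)
  then show ?thesis
    using assms by (simp add: shuffle_def half_twist_def fun_eq_iff place_rev')
qed

lemma shuffle_Suc:
  assumes "half_twist w" "m < 6"
  shows "shuffle w (Suc m) \<circ> transpose (w0 ! m - 1) (w0 ! m)
    = transpose (w ! m - 1) (w ! m) \<circ> shuffle w m"
proof -
  have "take (Suc m) v = take m v @ [v ! m]" if "half_twist v" for v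
    using that assms(2) by (simp add: half_twist_def take_Suc_conv_app_nth)
  from this[OF assms(1)] this[OF half_twist_standard] show ?thesis
    by (simp add: shuffle_def place_append place_Cons fun_eq_iff)
qed

lemma shuffle_ge:
  assumes "half_twist w" "j \<ge> 4"
  shows "shuffle w m j = j"
proof -
  have "set (take m w) \<subseteq> {1, 2, 3}" "set (rev (take m w0)) \<subseteq> {1, 2, 3}"
    using assms(1) half_twist_standard set_take_subset[of m w] set_take_subset[of m w0]
    by (auto simp: half_twist_def)
  then show ?thesis
    using assms(2) by (simp add: shuffle_def place_ge)
qed

lemma inj_transfer: "inj (transfer w)"
proof -
  have "inj (shuffle w m)" for m
    unfolding shuffle_def by (intro inj_compose inj_place)
  then have "inj (beside a (shuffle w m))" for m
    by (rule inj_beside)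
  from inj_eq[OF this] show ?thesis
    by (intro injI) (auto simp: transfer_def split: prod.splits if_splits)
qed

lemma transfer_outside:
  assumes "half_twist w" "k \<le> N \<or> N + 6 \<le> k"
  shows "transfer w (k, j) = (k, j)"
proof -
  have "k = N + 6" if "\<not> k < N" "\<not> N + 6 < k" "k \<noteq> N"
    using that assms(2) by simp
  then show ?thesis
    using assms by (cases "k = N"; cases "k < N"; cases "N + 6 < k")
      (auto simp: transfer_def shuffle_6)
qed

text \<open>The four branches run downwards, so upward strand ends on the lines of the half twist
  lie to their left or right, where nothing is permuted.\<close>

lemma transfer_up:
  assumes "half_twist w" and up: "\<not> level (braided w) k ! j"
  shows "transfer w (k, j) = (k, j)"
proof (cases "N \<le> k \<and> k \<le> N + 6")
  case True
  then have "j < a \<or> a + 4 \<le> j"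
    using up middle_nth[of "j - a"] level_middle[OF assms(1), of k]
    by (cases "j < a"; cases "j < a + 4") (auto simp: less_diff_conv2 simp del: append.simps)
  then show ?thesis
    using shuffle_ge[OF assms(1), of "j - a"] by (auto simp: transfer_def beside_def)
qed (auto simp: transfer_def)

lemma slice_point_outside:
  assumes "half_twist w" "k < N \<or> N + 6 \<le> k"
  shows "transfer w (slice_point k q) = slice_point k q"
  using assms by (cases q) (auto intro!: transfer_outside)

lemma boundary_point_level:
  assumes "half_twist w"
  shows "fst (boundary_point (braided w) q) \<le> N \<or> N + 6 \<le> fst (boundary_point (braided w) q)"
  using assms by (cases q) (simp_all add: length_slices)

lemma boundary_point_eq:
  assumes "half_twist w"
  shows "boundary_point (braided w) q = boundary_point (braided w0) q"
  using assms half_twist_standard by (cases q) (simp_all only: boundary_point.simps length_slices braided_simps)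

lemma transfer_boundary_point:
  assumes "half_twist w" "half_twist w'"
  shows "transfer w (boundary_point (braided w') q) = boundary_point (braided w') q"
  using transfer_outside[OF assms(1), of "fst (boundary_point (braided w') q)"
      "snd (boundary_point (braided w') q)"] boundary_point_level[OF assms(2), of q]
  by simp

lemma transfer_middle:
  "m \<le> 6 \<Longrightarrow> transfer w (N + m, j) = (N + m, beside a (shuffle w m) j)"
  by (simp add: transfer_def)

lemma level_transfer:
  assumes "half_twist w"
  shows "level (braided w) k ! snd (transfer w (k, j)) = level (braided w0) k ! j"
proof (cases "N \<le> k \<and> k \<le> N + 6 \<and> a \<le> j \<and> j < a + 4")
  case True
  define m where "m = k - N"
  have k: "k = N + m" "m \<le> 6"
    using True by (auto simp: m_def)
  have "set (take m w) \<subseteq> {1, 2, 3}" "set (rev (take m w0)) \<subseteq> {1, 2, 3}"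
    using assms half_twist_standard set_take_subset[of m w] set_take_subset[of m w0]
    by (auto simp: half_twist_def)
  moreover have j: "j - a < 4"
    using True by linarith
  ultimately have "shuffle w m (j - a) < 4"
    using True by (simp add: shuffle_def place_less_iff less_diff_conv2)
  then show ?thesis
    using True k j middle_nth[of "j - a"] middle_nth[of "shuffle w m (j - a)"] assms half_twist_standard
    by (simp add: transfer_middle beside_def level_middle del: append.simps)
next
  case False
  then have "transfer w (k, j) = (k, j)"
    using shuffle_ge[OF assms, of "j - a" "k - N"] by (auto simp: transfer_def beside_def)
  then show ?thesis
    using level_eq[OF assms] by simp
qed

lemma next_point_down:
  assumes "half_twist w" "m < 6" "level (braided w) (N + m) ! j"
  shows "next_point (braided w) (N + m, j)
    = (N + Suc m, beside a (transpose (w ! m - 1) (w ! m)) j)"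
proof -
  have "w ! m \<ge> 1"
    using slices_middle(2)[OF assms(1,2)] by auto
  then have "across (insert_braid A a B w ! (N + m)) (Top j)
      = Bot (beside a (transpose (w ! m - 1) (w ! m)) j)"
    by (simp only: slices_middle(1)[OF assms(1,2)] across_braid_slice)
  then show ?thesis
    using assms by (simp add: length_slices del: across.simps)
qed

lemma next_point_up:
  assumes "half_twist w" "m < 6" "\<not> level (braided w) (N + Suc m) ! j"
  shows "next_point (braided w) (N + Suc m, j)
    = (N + m, beside a (transpose (w ! m - 1) (w ! m)) j)"
proof -
  have "w ! m \<ge> 1"
    using slices_middle(2)[OF assms(1,2)] by auto
  then have "across (insert_braid A a B w ! (N + m)) (Bot j)
      = Top (beside a (transpose (w ! m - 1) (w ! m)) j)"
    by (simp only: slices_middle(1)[OF assms(1,2)] across_braid_slice)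
  then show ?thesis
    using assms by (simp del: across.simps)
qed

lemma up_outside:
  assumes "half_twist w" "N \<le> k" "k \<le> N + 6" "\<not> level (braided w) k ! j"
  shows "j < a \<or> a + 4 \<le> j"
  using assms middle_nth[of "j - a"] level_middle[OF assms(1-3)]
  by (cases "j < a"; cases "j < a + 4") (auto simp: less_diff_conv2 simp del: append.simps)

lemma beside_transpose_outside:
  "i \<in> {1, 2, 3} \<Longrightarrow> j < a \<or> a + 4 \<le> j \<Longrightarrow> beside a (transpose (i - 1) i) j = j"
  by (auto simp: beside_def transpose_def)

text \<open>The conjugation of successor functions. A downward step in the half twist is a
  transposition, for which \<open>shuffle_Suc\<close> gives the claim; an upward step there runs
  beside the branches and changes no position. Elsewhere the slices coincide and
  \<open>transfer\<close> is the identity.\<close>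

lemma next_point_transfer:
  assumes "half_twist w"
  shows "next_point (braided w) (transfer w p) = transfer w (next_point (braided w0) p)"
proof -
  obtain k j where p: "p = (k, j)"
    by (cases p)
  have lev: "level (braided w) k = level (braided w0) k"
    by (rule level_eq[OF assms])
  note w0 = half_twist_standard
  have len: "length (insert_braid A a B w) = length (insert_braid A a B w0)"
    by (simp only: length_slices[OF assms] length_slices[OF w0])
  show ?thesis
  proof (cases "level (braided w0) k ! j")
    case down: True
    show ?thesis
    proof (cases "N \<le> k \<and> k < N + 6")
      case True
      then obtain m where k: "k = N + m" and m: "m < 6"
        by (metis add_less_cancel_left le_iff_add)
      have "level (braided w) k ! beside a (shuffle w m) j"
        using level_transfer[OF assms, of k j] down m by (simp add: k transfer_middle)
      then have "next_point (braided w) (transfer w p)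
          = (N + Suc m, beside a (transpose (w ! m - 1) (w ! m) \<circ> shuffle w m) j)"
        using m assms by (simp add: p k transfer_middle next_point_down beside_comp del: next_point.simps)
      also have "\<dots> = transfer w (next_point (braided w0) p)"
        using m down next_point_down[OF w0 m] transfer_middle[of "Suc m" w] shuffle_Suc[OF assms m]
        by (simp add: p k beside_comp del: next_point.simps)
      finally show ?thesis .
    next
      case False
      then have fixed: "transfer w p = p"
        using transfer_outside[OF assms, of k j] p by auto
      have "next_point (braided w) p = next_point (braided w0) p"
        using False down lev len slices_outside[OF assms, of k] boundary_point_eq[OF assms]
        by (auto simp: p)
      moreover have "transfer w (next_point (braided w0) p) = next_point (braided w0) p"
        using False down slice_point_outside[OF assms, of k] transfer_boundary_point[OF assms w0]
        by (auto simp: p simp del: slice_point.simps boundary_point.simps)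
      ultimately show ?thesis
        by (simp add: fixed)
    qed
  next
    case up: False
    then have fixed: "transfer w p = p"
      using transfer_up[OF assms, of k j] lev p by simp
    show ?thesis
    proof (cases "N < k \<and> k \<le> N + 6")
      case True
      then obtain m where k: "k = N + Suc m" and m: "m < 6"
        by (metis Suc_le_lessD add_Suc_right add_le_cancel_left less_imp_Suc_add)
      have j: "j < a \<or> a + 4 \<le> j"
        using up_outside[OF w0, of k j] up True by simp
      have "next_point (braided v) p = (N + m, j)" if "half_twist v" for v
        using next_point_up[OF that m, of j] up lev level_eq[OF that, of k] slices_middle(2)[OF that m]
          beside_transpose_outside[OF _ j]
        by (simp add: p k del: next_point.simps)
      moreover have "transfer w (N + m, j) = (N + m, j)"
        using j m shuffle_ge[OF assms, of "j - a" m] by (auto simp: transfer_middle beside_def)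
      ultimately show ?thesis
        using assms w0 fixed by simp
    next
      case False
      then have outside: "k - 1 < N \<or> N + 6 \<le> k - 1" if "k > 0"
        using that by auto
      have "next_point (braided w) p = next_point (braided w0) p"
        using up lev slices_outside[OF assms outside] boundary_point_eq[OF assms]
        by (auto simp: p)
      moreover have "transfer w (next_point (braided w0) p) = next_point (braided w0) p"
        using up slice_point_outside[OF assms outside] transfer_boundary_point[OF assms w0]
        by (auto simp: p simp del: slice_point.simps boundary_point.simps)
      ultimately show ?thesis
        by (simp add: fixed)
    qed
  qed
qed

section \<open>Times along the four branches\<close>

abbreviation base :: "nat \<times> nat" where "base \<equiv> boundary_point (braided w0) x"

text \<open>Both orbits start at the same boundary point, which \<open>transfer\<close> fixes. Since
  \<open>transfer\<close> is injective, corresponding points are reached at exactly the same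
  steps.\<close>

lemma time_transfer:
  assumes "half_twist w"
  shows "time (braided w) (transfer w p) = time (braided w0) p"
proof -
  have base: "boundary_point (braided w) x = transfer w base"
    using boundary_point_eq[OF assms, of x] transfer_boundary_point[OF assms half_twist_standard, of x]
    by simp
  have "(next_point (braided w) ^^ m) (transfer w q) = transfer w ((next_point (braided w0) ^^ m) q)"
    for m q
    by (induction m) (simp_all add: next_point_transfer[OF assms] del: next_point.simps)
  then show ?thesis
    unfolding time_def base braided_simps by (simp add: inj_eq[OF inj_transfer])
qed

definition branch_point :: "nat list \<Rightarrow> nat \<Rightarrow> nat \<Rightarrow> nat \<times> nat" where
  "branch_point w m b = (N + m, a + place (take m w) b)"

text \<open>The time at which the circle enters the half twist on branch \<open>b\<close>; by
  \<open>time_transfer\<close> it is the same in all diagrams.\<close>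

definition branch_time :: "nat \<Rightarrow> nat" where
  "branch_time b = time (braided w0) (branch_point w0 0 b)"

lemma take_place_less:
  assumes "half_twist w" "b < 4"
  shows "place (take m w) b < 4" and "place (rev (take m w)) b < 4"
proof -
  have "set (take m w) \<subseteq> {1, 2, 3}" "set (rev (take m w)) \<subseteq> {1, 2, 3}"
    using assms set_take_subset[of m w] by (auto simp: half_twist_def)
  then show "place (take m w) b < 4" and "place (rev (take m w)) b < 4"
    using assms(2) place_less_iff by blast+
qed

lemma transfer_branch_point:
  assumes "half_twist w" "m \<le> 6"
  shows "transfer w (branch_point w0 m b) = branch_point w m b"
  using assms by (simp add: branch_point_def transfer_middle shuffle_def place_rev)

lemma level_branch_point:
  assumes "half_twist w" "m \<le> 6" "b < 4"
  shows "level (braided w) (N + m) ! (a + place (take m w) b)"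
  using assms take_place_less[OF assms(1,3)] middle_nth by (simp add: level_middle del: append.simps)

lemma next_branch_point:
  assumes "half_twist w" "m < 6" "b < 4"
  shows "next_point (braided w) (branch_point w m b) = branch_point w (Suc m) b"
proof -
  have "take (Suc m) w = take m w @ [w ! m]"
    using assms(1,2) by (simp add: half_twist_def take_Suc_conv_app_nth)
  then show ?thesis
    using assms next_point_down[OF assms(1,2) level_branch_point]
    by (simp add: branch_point_def place_append place_Cons del: next_point.simps)
qed

text \<open>Uniqueness of the predecessor. For \<open>m < 5\<close> the target is on an inner line
  of the half twist: it is no boundary point, both adjacent slices are crossings, and no upward
  strand passes through it. So it is reached only from above, through a transposition.\<close>

lemma next_point_eq_branch_point:
  assumes w: "half_twist w" and m: "m < 5" and b: "b < 4"
    and nxt: "next_point (braided w) p = branch_point w (Suc m) b"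
  shows "p = branch_point w m b"
proof -
  obtain k j where p: "p = (k, j)"
    by (cases p)
  define c where "c = place (take (Suc m) w) b"
  have c: "c < 4"
    unfolding c_def by (rule take_place_less[OF w b])
  have target: "next_point (braided w) (k, j) = (N + Suc m, a + c)"
    using nxt by (simp add: p branch_point_def c_def del: next_point.simps)
  have not_boundary: "boundary_point (braided w) q \<noteq> (N + Suc m, a + c)" for q
    using boundary_point_level[OF w, of q] m by auto
  have slice: "\<exists>i. insert_braid A a B w ! (N + m') = (i, Cross True)" if "m' < 6" for m'
    using slices_middle(1)[OF w that] by auto
  show ?thesis
  proof (cases "level (braided w) k ! j")
    case down: True
    have "k < length (insert_braid A a B w)"
      using target down not_boundary by (auto split: if_splits)
    with target down have
      point: "slice_point k (across (insert_braid A a B w ! k) (Top j)) = (N + Suc m, a + c)"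
      by simp
    then have "N + Suc m = k \<or> N + Suc m = Suc k"
      by (cases "across (insert_braid A a B w ! k) (Top j)") auto
    \<comment> \<open>The other alternative is a turn at a local minimum, but this slice is a
      crossing.\<close>
    moreover have "N + Suc m \<noteq> k"
      using slice[of "Suc m"] m point by auto
    ultimately have k: "k = N + m"
      by simp
    have inj: "inj (beside a (transpose (w ! m - 1) (w ! m)))"
      by (intro inj_beside inj_on_subset[OF bij_is_inj]) auto
    have m6: "m < 6"
      using m by simp
    have "next_point (braided w) (N + m, a + place (take m w) b) = next_point (braided w) (N + m, j)"
      using next_branch_point[OF w m6 b] nxt by (simp only: branch_point_def p k)
    then have "beside a (transpose (w ! m - 1) (w ! m)) (a + place (take m w) b)
        = beside a (transpose (w ! m - 1) (w ! m)) j"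
      using level_branch_point[OF w less_imp_le[OF m6] b] down
      by (simp only: next_point_down[OF w m6] k prod.inject)
    then have "a + place (take m w) b = j"
      by (rule injD[OF inj])
    then show ?thesis
      by (simp add: p k branch_point_def)
  next
    case up: False
    have "k > 0"
      using target up not_boundary by (auto split: if_splits)
    with target up have
      point: "slice_point (k - 1) (across (insert_braid A a B w ! (k - 1)) (Bot j)) = (N + Suc m, a + c)"
      by simp
    then have "N + Suc m = k - 1 \<or> N + Suc m = k"
      using \<open>k > 0\<close> by (cases "across (insert_braid A a B w ! (k - 1)) (Bot j)") auto
    \<comment> \<open>Here the other alternative is a turn at a local maximum.\<close>
    moreover have "N + Suc m \<noteq> k"
      using slice[of m] m point by auto
    ultimately have k: "k = N + Suc (Suc m)"
      using \<open>k > 0\<close> by simp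
    have "j < a \<or> a + 4 \<le> j"
      using up_outside[OF w _ _ up] m k by simp
    moreover have "j = a + c"
      using next_point_up[OF w, of "Suc m" j] up m k target slices_middle(2)[OF w, of "Suc m"]
        beside_transpose_outside[OF _ calculation] by (simp del: next_point.simps)
    ultimately show ?thesis
      using c by simp
  qed
qed

lemma reached:
  assumes "k \<le> N + 6 + length B" "j < length (level (braided w0) k)"
  shows "\<exists>m. (next_point (braided w0) ^^ m) base = (k, j)"
  using closed assms length_slices[OF half_twist_standard]
  unfolding closed_string_link_def one_circle_def standard_word_def[symmetric] braided_def[symmetric] braided_simps
  by (simp del: next_point.simps boundary_point.simps)

lemma time_point:
  assumes "k \<le> N + 6 + length B" "j < length (level (braided w0) k)"
  shows "(next_point (braided w0) ^^ time (braided w0) (k, j)) base = (k, j)"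
  unfolding time_def braided_simps by (rule LeastI_ex[OF reached[OF assms]])

lemma branch_point_time:
  assumes "m \<le> 6" "b < 4"
  shows "(next_point (braided w0) ^^ time (braided w0) (branch_point w0 m b)) base
    = branch_point w0 m b"
  unfolding branch_point_def
  using assms take_place_less[OF half_twist_standard assms(2)]
  by (intro time_point) (auto simp: level_middle[OF half_twist_standard] trans_less_add1)

text \<open>One inequality follows by stepping on from the previous branch point, the other by
  stepping back from the first arrival, since predecessors are unique.\<close>

lemma time_Suc_branch_point:
  assumes "m < 5" "b < 4"
  shows "time (braided w0) (branch_point w0 (Suc m) b) = Suc (time (braided w0) (branch_point w0 m b))"
proof -
  let ?orbit = "\<lambda>m. (next_point (braided w0) ^^ m) base"
  have le: "time (braided w0) p \<le> l" if "?orbit l = p" for p l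
    unfolding time_def braided_simps using that by (rule Least_le)
  have "?orbit (Suc (time (braided w0) (branch_point w0 m b))) = branch_point w0 (Suc m) b"
    using assms branch_point_time[of m b] next_branch_point[OF half_twist_standard, of m b]
    by (simp del: next_point.simps)
  moreover obtain l where l: "time (braided w0) (branch_point w0 (Suc m) b) = Suc l"
  proof (cases "time (braided w0) (branch_point w0 (Suc m) b)")
    \<comment> \<open>The circle starts on the boundary, hence not on an inner line of the half
      twist.\<close>
    case 0
    have "Suc m \<le> 6"
      using assms(1) by simp
    from branch_point_time[OF this assms(2)] have "base = branch_point w0 (Suc m) b"
      by (simp only: 0 funpow_0)
    then show ?thesis
      using boundary_point_level[OF half_twist_standard, of x] assms(1)
      by (auto simp: branch_point_def simp del: boundary_point.simps)
  qed (rule that)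
  moreover have "?orbit l = branch_point w0 m b"
  proof (rule next_point_eq_branch_point[OF half_twist_standard assms])
    have "Suc m \<le> 6"
      using assms(1) by simp
    from branch_point_time[OF this assms(2)]
    show "next_point (braided w0) (?orbit l) = branch_point w0 (Suc m) b"
      by (simp only: l funpow.simps o_apply)
  qed
  ultimately show ?thesis
    using le[of "Suc (time (braided w0) (branch_point w0 m b))"] le[of l]
    by (metis le_antisym Suc_le_mono)
qed

lemma time_branch_point:
  assumes "half_twist w" "m < 6" "b < 4"
  shows "time (braided w) (branch_point w m b) = branch_time b + m"
proof -
  have "time (braided w0) (branch_point w0 m b) = branch_time b + m"
    using assms(2) by (induction m) (simp_all add: branch_time_def time_Suc_branch_point[OF _ assms(3)])
  then show ?thesis
    using time_transfer[OF assms(1), of "branch_point w0 m b"] assms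
    by (simp add: transfer_branch_point)
qed

lemma time_eq_branch_time:
  assumes "k \<le> N + 6 + length B" "j < length (level (braided w0) k)"
    and "time (braided w0) (k, j) = branch_time b + m" "m < 6" "b < 4"
  shows "(k, j) = branch_point w0 m b"
  using time_point[OF assms(1,2)] branch_point_time[of m b] assms(3-)
    time_branch_point[OF half_twist_standard, of m b]
  by simp

text \<open>At equal times the circle is at the same point, but different branches share no
  point.\<close>

lemma branch_time_neq:
  assumes "b < 4" "c < 4" "b \<noteq> c" "m < 6" "l < 6"
  shows "branch_time b + m \<noteq> branch_time c + l"
proof
  assume eq: "branch_time b + m = branch_time c + l"
  have "branch_point w0 m b = branch_point w0 l c"
    using branch_point_time[of m b] branch_point_time[of l c] assms eq
      time_branch_point[OF half_twist_standard, of m b] time_branch_point[OF half_twist_standard, of l c]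
    by simp
  then show False
    using assms(3) inj_eq[OF inj_place] by (auto simp: branch_point_def)
qed

section \<open>Crossings outside the half twist\<close>

lemma arrival_outside:
  assumes "half_twist w" "k < N \<or> N + 6 \<le> k"
  shows "arrival (braided w) k j = arrival (braided w0) k j"
proof -
  have "transfer w (slice_point k q) = slice_point k q" for q
    by (rule slice_point_outside[OF assms])
  moreover have "transfer w (k, j) = (k, j)"
    using assms by (intro transfer_outside) auto
  ultimately show ?thesis
    using time_transfer[OF assms(1)] level_eq[OF assms(1), of k] slices_outside[OF assms]
    by (simp add: arrival_def) metis
qed

lemma over_time_outside:
  assumes "half_twist w" "k < N \<or> N + 6 \<le> k"
  shows "over_time (braided w) k = over_time (braided w0) k"
  using assms by (simp add: over_time_def slices_outside arrival_outside)

lemma under_time_outside: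
  assumes "half_twist w" "k < N \<or> N + 6 \<le> k"
  shows "under_time (braided w) k = under_time (braided w0) k"
  using assms by (simp add: under_time_def slices_outside arrival_outside)

lemma writhe_outside:
  assumes "half_twist w" "k < N \<or> N + 6 \<le> k"
  shows "writhe (braided w) k = writhe (braided w0) k"
  using assms by (simp add: writhe_def slices_outside level_eq)

definition outer_crossings :: "nat set" where
  "outer_crossings = {k \<in> crossings (braided w0). k < N \<or> N + 6 \<le> k}"

lemma finite_outer_crossings: "finite outer_crossings"
  by (simp add: outer_crossings_def crossings_def)

lemma crossings_braided:
  assumes "half_twist w"
  shows "crossings (braided w) = outer_crossings \<union> (\<lambda>m. N + m) ` {..<6}"
proof (intro set_eqI)
  fix k
  show "k \<in> crossings (braided w) \<longleftrightarrow> k \<in> outer_crossings \<union> (\<lambda>m. N + m) ` {..<6}"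
  proof (cases "k < N \<or> N + 6 \<le> k")
    case True
    then show ?thesis
      using slices_outside[OF assms True]
      by (auto simp: crossings_def outer_crossings_def length_slices[OF assms]
          length_slices[OF half_twist_standard])
  next
    case False
    then obtain m where "k = N + m" "m < 6"
      by (metis add_less_cancel_left le_iff_add not_less)
    then show ?thesis
      using slices_middle(1)[OF assms]
      by (auto simp: crossings_def outer_crossings_def length_slices[OF assms])
  qed
qed

text \<open>Guarantees that the ends of the two strands of a crossing are points of the diagram,
  which the circle therefore reaches.\<close>

lemma crossing_valid:
  assumes "k < length (insert_braid A a B w0)" "insert_braid A a B w0 ! k = (i, Cross c)"
  shows "Suc i < length (level (braided w0) k)"
    and "level (braided w0) (Suc k)
      = (level (braided w0) k)[i := level (braided w0) k ! Suc i, Suc i := level (braided w0) k ! i]"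
proof -
  let ?D = "insert_braid A a B w0"
  have "run s ?D \<noteq> None"
    using closed unfolding closed_string_link_def diagram_def standard_word_def by auto
  then have "run s (take (Suc k) ?D @ drop (Suc k) ?D) \<noteq> None"
    by simp
  then obtain v where v: "run s (take (Suc k) ?D) = Some v"
    by (auto simp only: run_append split: bind_splits)
  then have "Option.bind (run s (take k ?D)) (\<lambda>u. run u [?D ! k]) = Some v"
    using assms(1) by (simp add: take_Suc_conv_app_nth run_append)
  then obtain u where u: "run s (take k ?D) = Some u" "step u (i, Cross c) = Some v"
    using assms(2) by (auto split: bind_splits)
  then show "Suc i < length (level (braided w0) k)"
    and "level (braided w0) (Suc k)
      = (level (braided w0) k)[i := level (braided w0) k ! Suc i, Suc i := level (braided w0) k ! i]"
    using v by (auto simp: level_def split: if_splits)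
qed

text \<open>At equal times the arrival point would be a branch point. A downward strand arrives on
  the line above its slice, which is none of the lines in question; an upward strand may arrive on
  the top line of the half twist, but branch points are oriented downwards.\<close>

lemma arrival_avoids_branches:
  assumes k: "k \<in> outer_crossings" and i: "slices (braided w0) ! k = (i, Cross c)"
    and j: "j = i \<or> j = Suc i" and m: "m < 6" and b: "b < 4"
  shows "arrival (braided w0) k j \<noteq> branch_time b + m"
proof
  assume eq: "arrival (braided w0) k j = branch_time b + m"
  have k': "k < N + 6 + length B" "k < N \<or> N + 6 \<le> k"
    using k length_slices[OF half_twist_standard] by (auto simp: outer_crossings_def crossings_def)
  have valid: "Suc i < length (level (braided w0) k)"
    "level (braided w0) (Suc k)
      = (level (braided w0) k)[i := level (braided w0) k ! Suc i, Suc i := level (braided w0) k ! i]"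
    using crossing_valid[of k i c] k' i length_slices[OF half_twist_standard] by simp_all
  show False
  proof (cases "level (braided w0) k ! j")
    case True
    then have "(k, j) = branch_point w0 m b"
      using eq k' valid(1) j m b by (intro time_eq_branch_time) (auto simp: arrival_def)
    then show False
      using k'(2) m by (auto simp: branch_point_def)
  next
    case False
    \<comment> \<open>The end below the slice, where an upward strand arrives.\<close>
    define j' where "j' = (if j = i then Suc i else i)"
    have j': "j' < length (level (braided w0) (Suc k))" "\<not> level (braided w0) (Suc k) ! j'"
      using False valid j by (auto simp: j'_def)
    have "(Suc k, j') = branch_point w0 m b"
    proof (rule time_eq_branch_time)
      show "time (braided w0) (Suc k, j') = branch_time b + m"
        using eq False i j by (auto simp: arrival_def j'_def)
    qed (use k' j' m b in auto)
    moreover from this have "level (braided w0) (Suc k) ! j'"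
      using level_branch_point[OF half_twist_standard, of m b] m b by (simp add: branch_point_def)
    ultimately show False
      using j'(2) by simp
  qed
qed

lemma outer_avoids_branches:
  assumes "k \<in> outer_crossings" "m < 6" "b < 4"
  shows "over_time (braided w0) k \<noteq> branch_time b + m"
    and "under_time (braided w0) k \<noteq> branch_time b + m"
proof -
  obtain i c where "slices (braided w0) ! k = (i, Cross c)"
    using assms(1) by (auto simp: outer_crossings_def crossings_def)
  then show "over_time (braided w0) k \<noteq> branch_time b + m"
    and "under_time (braided w0) k \<noteq> branch_time b + m"
    using arrival_avoids_branches[OF assms(1) _ _ assms(2,3), of i c]
    by (simp_all add: over_time_def under_time_def)
qed

section \<open>Crossings in the half twist\<close>

lemma branch_less:
  assumes "half_twist w" "m < 6"
  shows "under_branch w m < 4" and "over_branch w m < 4"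
  using assms slices_middle(2)[OF assms] take_place_less(2)[OF assms(1)]
  by (auto simp: under_branch_def over_branch_def)

lemma arrival_middle:
  assumes "half_twist w" "m < 6" "c < 4"
  shows "arrival (braided w) (N + m) (a + c) = branch_time (place (rev (take m w)) c) + m"
proof -
  have "(N + m, a + c) = branch_point w m (place (rev (take m w)) c)"
    by (simp add: branch_point_def place_rev')
  moreover have "level (braided w) (N + m) = middle"
    using assms(1,2) by (intro level_middle) auto
  then have "level (braided w) (N + m) ! (a + c)"
    using middle_nth[OF assms(3)] by (simp only:)
  ultimately show ?thesis
    using time_branch_point[OF assms(1,2) take_place_less(2)[OF assms(1,3)], of m]
    by (simp add: arrival_def)
qed

lemma under_time_middle:
  assumes "half_twist w" "m < 6"
  shows "under_time (braided w) (N + m) = branch_time (under_branch w m) + m"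
  using arrival_middle[OF assms, of "w ! m - 1"] slices_middle[OF assms]
  by (auto simp: under_time_def under_branch_def)

lemma over_time_middle:
  assumes "half_twist w" "m < 6"
  shows "over_time (braided w) (N + m) = branch_time (over_branch w m) + m"
proof -
  have "a + (w ! m - 1) + 1 = a + w ! m" "w ! m < 4"
    using slices_middle(2)[OF assms] by auto
  then show ?thesis
    using arrival_middle[OF assms, of "w ! m"]
    by (simp only: over_time_def over_branch_def braided_simps slices_middle(1)[OF assms] prod.case
        if_True simp_thms)
qed

lemma writhe_middle:
  assumes "half_twist w" "m < 6"
  shows "writhe (braided w) (N + m) = 1"
proof -
  have *: "a + (w ! m - 1) + 1 = a + w ! m" "w ! m < 4" "w ! m - 1 < 4"
    using slices_middle(2)[OF assms] by auto
  have "level (braided w) (N + m) = middle"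
    using assms by (intro level_middle) auto
  then show ?thesis
    using middle_nth[OF *(2)] middle_nth[OF *(3)]
    by (simp only: writhe_def braided_simps slices_middle(1)[OF assms] prod.case *(1) if_True
        simp_thms)
qed

section \<open>Identification of the weights with the model\<close>

abbreviation L :: "nat \<Rightarrow> nat \<Rightarrow> bool" where
  "L b c \<equiv> branch_time b < branch_time c"

definition X :: "nat \<Rightarrow> nat \<Rightarrow> int" where
  "X u v = (\<Sum>k\<in>outer_crossings. of_bool (branch_time u < over_time (braided w0) k \<and>
     over_time (braided w0) k < branch_time v \<and> branch_time v < under_time (braided w0) k)
       * writhe (braided w0) k)"

text \<open>An outer f-crossing can have r-crossings in the half twist. They enter only through
  their pairs of branches, so the word does not appear.\<close>

definition G :: "nat \<Rightarrow> int" where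
  "G b = (\<Sum>f\<in>outer_crossings.
     of_bool (under_time (braided w0) f < over_time (braided w0) f \<and>
       under_time (braided w0) f < branch_time b) * (writhe (braided w0) f *
     ((\<Sum>k\<in>outer_crossings.
         of_bool (under_time (braided w0) f < over_time (braided w0) k \<and>
           over_time (braided w0) k < over_time (braided w0) f \<and>
           over_time (braided w0) f < under_time (braided w0) k) * writhe (braided w0) k) +
      (\<Sum>(u, v)\<in>crossing_pairs.
         of_bool (under_time (braided w0) f < branch_time v \<and>
           branch_time v < over_time (braided w0) f \<and> over_time (braided w0) f < branch_time u)))))"

text \<open>The circle spends six consecutive times on a branch, and these intervals are disjoint
  for different branches. So the entry times decide between different branches and the letters
  decide on one branch.\<close>

lemma branch_time_less_iff:
  assumes "b < 4" "c < 4" "m < 6" "l < 6"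
  shows "branch_time b + m < branch_time c + l \<longleftrightarrow> earlier L (b, m) (c, l)"
proof -
  have less: "branch_time b + m < branch_time c + l"
    if "branch_time b < branch_time c" "b < 4" "c < 4" "m < 6" for b c m l
  proof (rule ccontr)
    assume "\<not> branch_time b + m < branch_time c + l"
    then have "branch_time c - branch_time b < 6" "branch_time b + (branch_time c - branch_time b) = branch_time c"
      using that(1,4) by linarith+
    then show False
      using branch_time_neq[of b c "branch_time c - branch_time b" 0] that by fastforce
  qed
  show ?thesis
  proof (cases "b = c")
    case False
    then have "branch_time b \<noteq> branch_time c"
      using branch_time_neq[of b c 0 0] assms by simp
    then show ?thesis
      using less[of b c m l] less[of c b l m] assms False
      by (cases "branch_time b < branch_time c") simp_all
  qed simp
qed

lemma branch_order_L: "branch_order L"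
proof
  fix b c :: nat
  assume "b < 4" "c < 4" "b \<noteq> c"
  then show "L b c \<longleftrightarrow> \<not> L c b"
    using branch_time_neq[of b c 0 0] by (simp add: not_less_iff_gr_or_eq)
qed simp

text \<open>The six times of a branch contain no time of an outer crossing, so the offset
  \<open>m\<close> is invisible from outside.\<close>

lemma outer_less_iff:
  assumes "k \<in> outer_crossings" "m < 6" "b < 4"
  shows "over_time (braided w0) k < branch_time b + m \<longleftrightarrow> over_time (braided w0) k < branch_time b"
    and "branch_time b + m < over_time (braided w0) k \<longleftrightarrow> branch_time b < over_time (braided w0) k"
    and "under_time (braided w0) k < branch_time b + m \<longleftrightarrow> under_time (braided w0) k < branch_time b"
    and "branch_time b + m < under_time (braided w0) k \<longleftrightarrow> branch_time b < under_time (braided w0) k"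
proof -
  have avoid: "(l < branch_time b + m \<longleftrightarrow> l < branch_time b) \<and>
      (branch_time b + m < l \<longleftrightarrow> branch_time b < l)"
    if "\<And>i. i < 6 \<Longrightarrow> l \<noteq> branch_time b + i" for l
    using that[of "l - branch_time b"] assms(2) by linarith
  show "over_time (braided w0) k < branch_time b + m \<longleftrightarrow> over_time (braided w0) k < branch_time b"
    and "branch_time b + m < over_time (braided w0) k \<longleftrightarrow> branch_time b < over_time (braided w0) k"
    using avoid[OF outer_avoids_branches(1)[OF assms(1) _ assms(3)]] by simp_all
  show "under_time (braided w0) k < branch_time b + m \<longleftrightarrow> under_time (braided w0) k < branch_time b"
    and "branch_time b + m < under_time (braided w0) k \<longleftrightarrow> branch_time b < under_time (braided w0) k"
    using avoid[OF outer_avoids_branches(2)[OF assms(1) _ assms(3)]] by simp_all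
qed

lemma outer_crossingsD: "k \<in> outer_crossings \<Longrightarrow> k < N \<or> N + 6 \<le> k"
  by (simp add: outer_crossings_def)

lemma sum_crossings:
  fixes g :: "nat \<Rightarrow> int"
  assumes "half_twist w"
  shows "(\<Sum>k\<in>{k \<in> crossings (braided w). P k}. g k)
    = (\<Sum>k\<in>outer_crossings. of_bool (P k) * g k) + (\<Sum>l<6. of_bool (P (N + l)) * g (N + l))"
proof -
  have "finite (crossings (braided w))"
    by (simp add: crossings_def)
  then have "(\<Sum>k\<in>{k \<in> crossings (braided w). P k}. g k)
      = (\<Sum>k\<in>crossings (braided w). of_bool (P k) * g k)"
    by (simp add: Int_def)
  also have "\<dots> = (\<Sum>k\<in>outer_crossings. of_bool (P k) * g k)
      + (\<Sum>k\<in>(\<lambda>m. N + m) ` {..<6}. of_bool (P k) * g k)"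
    unfolding crossings_braided[OF assms]
    by (rule sum.union_disjoint) (auto simp: finite_outer_crossings dest: outer_crossingsD)
  also have "(\<Sum>k\<in>(\<lambda>m. N + m) ` {..<6}. of_bool (P k) * g k) = (\<Sum>l<6. of_bool (P (N + l)) * g (N + l))"
    by (subst sum.reindex) (auto simp: inj_on_def)
  finally show ?thesis .
qed

lemma sum_r_crossings:
  assumes "half_twist w"
  shows "(\<Sum>k\<in>r_crossings (braided w) f. writhe (braided w) k)
    = (\<Sum>k\<in>outer_crossings. of_bool (under_time (braided w) f < over_time (braided w0) k \<and>
         over_time (braided w0) k < over_time (braided w) f \<and>
         over_time (braided w) f < under_time (braided w0) k) * writhe (braided w0) k)
    + (\<Sum>l<6. of_bool (under_time (braided w) f < branch_time (over_branch w l) + l \<and>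
         branch_time (over_branch w l) + l < over_time (braided w) f \<and>
         over_time (braided w) f < branch_time (under_branch w l) + l))"
  unfolding r_crossings_def sum_crossings[OF assms]
  by (intro arg_cong2[of _ _ _ _ "(+)"] sum.cong refl)
    (auto simp: over_time_outside[OF assms] under_time_outside[OF assms] writhe_outside[OF assms]
      over_time_middle[OF assms] under_time_middle[OF assms] writhe_middle[OF assms]
      dest!: outer_crossingsD)

lemma sum_r_crossings_middle:
  assumes "half_twist w" "m < 6"
  shows "(\<Sum>k\<in>r_crossings (braided w) (N + m). writhe (braided w) k)
    = model_r L X (passages w) (m, under_branch w m, over_branch w m)"
  unfolding sum_r_crossings[OF assms(1)] model_r.simps sum_passages X_def
    under_time_middle[OF assms] over_time_middle[OF assms]
  using branch_less[OF assms] branch_less[OF assms(1)] assms(2)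
  by (intro arg_cong2[of _ _ _ _ "(+)"] sum.cong refl)
    (simp_all add: outer_less_iff branch_time_less_iff del: earlier.simps)

text \<open>Once the offsets are dropped by \<open>outer_less_iff\<close>, the inner summand depends
  only on the pair of branches, and \<open>sum_crossing_pairs\<close> eliminates the word.\<close>

lemma sum_r_crossings_outer:
  assumes "half_twist w" "f \<in> outer_crossings"
  shows "(\<Sum>k\<in>r_crossings (braided w) f. writhe (braided w) k)
    = (\<Sum>k\<in>outer_crossings.
         of_bool (under_time (braided w0) f < over_time (braided w0) k \<and>
           over_time (braided w0) k < over_time (braided w0) f \<and>
           over_time (braided w0) f < under_time (braided w0) k) * writhe (braided w0) k) +
      (\<Sum>(u, v)\<in>crossing_pairs.
         of_bool (under_time (braided w0) f < branch_time v \<and>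
           branch_time v < over_time (braided w0) f \<and> over_time (braided w0) f < branch_time u))"
  unfolding sum_r_crossings[OF assms(1)] sum_crossing_pairs[OF assms(1), symmetric]
    under_time_outside[OF assms(1) outer_crossingsD[OF assms(2)]]
    over_time_outside[OF assms(1) outer_crossingsD[OF assms(2)]]
  using branch_less[OF assms(1)]
  by (intro arg_cong2[of _ _ _ _ "(+)"] sum.cong refl) (simp_all add: outer_less_iff[OF assms(2)])

text \<open>The middle branch is observed at \<open>ml\<close>, the low and high ones at
  \<open>d\<close>. The two inequations make it a third branch, so that the different offsets do not
  matter.\<close>

lemma triple_order:
  assumes "half_twist w" "h \<le> 3"
    and "over_branch w h \<noteq> under_branch w (h + 1)" "over_branch w h \<noteq> over_branch w (h + 1)"
  shows "mid_time (braided w) (N + h) < high_time (braided w) (N + h)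
      \<longleftrightarrow> L (over_branch w h) (over_branch w (h + 1))"
    and "mid_time (braided w) (N + h) < low_time (braided w) (N + h)
      \<longleftrightarrow> L (over_branch w h) (under_branch w (h + 1))"
  using assms over_time_middle[OF assms(1), of h] over_time_middle[OF assms(1), of "Suc h"]
    under_time_middle[OF assms(1), of "Suc h"] branch_less[OF assms(1)]
    branch_time_less_iff[of "over_branch w h" _ h "Suc h"]
  by (simp_all add: mid_time_def high_time_def low_time_def crossing_ml_def crossing_d_def)

lemma under_branch_neq_over_branch:
  assumes "half_twist w" "m < 6"
  shows "under_branch w m \<noteq> over_branch w m"
proof -
  have "w ! m - 1 \<noteq> w ! m"
    using slices_middle(2)[OF assms] by auto
  then show ?thesis
    by (simp add: under_branch_def over_branch_def inj_eq[OF inj_place])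
qed

text \<open>Both strands pass \<open>d\<close> at the same letter, so the offsets cancel.\<close>

lemma distinguished_order:
  assumes "half_twist w" "h \<le> 3"
  shows "high_time (braided w) (N + h) < low_time (braided w) (N + h)
      \<longleftrightarrow> L (over_branch w (h + 1)) (under_branch w (h + 1))"
    and "low_time (braided w) (N + h) < high_time (braided w) (N + h)
      \<longleftrightarrow> L (under_branch w (h + 1)) (over_branch w (h + 1))"
    and "type_0 (braided w) (crossing_d (N + h))
      \<longleftrightarrow> L (over_branch w (h + 1)) (under_branch w (h + 1))"
  using assms over_time_middle[OF assms(1), of "Suc h"] under_time_middle[OF assms(1), of "Suc h"]
    branch_less[OF assms(1), of "Suc h"] under_branch_neq_over_branch[OF assms(1), of "Suc h"]
    branch_time_neq[of "under_branch w (Suc h)" "over_branch w (Suc h)" 0 0]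
  by (auto simp: high_time_def low_time_def crossing_d_def type_0_def type_1_def not_less)

lemma W1_eq:
  assumes "half_twist w" "h \<le> 3"
    and "over_branch w h \<noteq> under_branch w (h + 1)" "over_branch w h \<noteq> over_branch w (h + 1)"
  shows "(if global_type_lc (braided w) (N + h) \<or> global_type_ra (braided w) (N + h)
      then W1 (braided w) (N + h) else 0) = model_W1 L X (passages w) h"
proof -
  have "W1 (braided w) (N + h) = model_r L X (passages w) (passages w ! (h + 2))"
    using sum_r_crossings_middle[OF assms(1), of "h + 2"] assms(2)
    by (simp add: W1_def crossing_hm_def nth_passages add.assoc)
  moreover have "passages w ! h = (h, under_branch w h, over_branch w h)"
    "passages w ! (h + 1) = (h + 1, under_branch w (h + 1), over_branch w (h + 1))"
    using assms(2) by (intro nth_passages; simp)+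
  ultimately show ?thesis
    unfolding model_W1_def Let_def global_type_lc_def global_type_ra_def triple_order[OF assms]
      distinguished_order[OF assms(1,2)]
    by (simp only: prod.case)
qed

lemma W2_eq:
  assumes "half_twist w" "h \<le> 3"
  shows "(if type_0 (braided w) (crossing_d (N + h)) then W2 (braided w) (N + h) else 0)
    = model_W2 L X G (passages w) h"
proof -
  let ?d = "N + (h + 1)" and ?high = "over_branch w (h + 1)"
  let ?W = "\<lambda>f. \<Sum>r\<in>r_crossings (braided w) f. writhe (braided w) r"
  let ?P = "\<lambda>q. q \<noteq> ?d \<and> type_1 (braided w) q \<and> under_time (braided w) q < over_time (braided w) ?d"
  have h: "h + 1 < 6"
    using assms(2) by simp
  have d: "over_time (braided w) ?d = branch_time ?high + (h + 1)"
    by (rule over_time_middle[OF assms(1) h])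
  note high = branch_less(2)[OF assms(1) h]
  \<comment> \<open>For f-crossings outside, neither the condition nor the weight sees the
    word.\<close>
  have outer: "(\<Sum>f\<in>outer_crossings. of_bool (?P f) * (writhe (braided w) f * ?W f)) = G ?high"
    unfolding G_def
  proof (intro sum.cong refl arg_cong2[of _ _ _ _ "(*)"])
    fix f assume f: "f \<in> outer_crossings"
    note out = outer_crossingsD[OF f]
    show "(of_bool (?P f) :: int) = of_bool (under_time (braided w0) f < over_time (braided w0) f \<and>
        under_time (braided w0) f < branch_time ?high)"
      unfolding type_1_def d under_time_outside[OF assms(1) out] over_time_outside[OF assms(1) out]
        outer_less_iff(3)[OF f h high]
      using out h by auto
    show "writhe (braided w) f = writhe (braided w0) f"
      by (rule writhe_outside[OF assms(1) out])
  qed (rule sum_r_crossings_outer[OF assms(1)])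
  \<comment> \<open>Here the letter \<open>h + 1\<close> of \<open>d\<close> matters: the
    under-cross of \<open>f\<close> may lie on the high branch itself.\<close>
  have inner: "of_bool (?P (N + m)) * (writhe (braided w) (N + m) * ?W (N + m))
      = of_bool (m \<noteq> h + 1 \<and> earlier L (under_branch w m, m) (over_branch w m, m) \<and>
            earlier L (under_branch w m, m) (?high, h + 1))
          * model_r L X (passages w) (m, under_branch w m, over_branch w m)"
    if "m < 6" for m
    using branch_less[OF assms(1) that] that h high
    by (simp only: writhe_middle[OF assms(1) that] sum_r_crossings_middle[OF assms(1) that] type_1_def d
        under_time_middle[OF assms(1) that] over_time_middle[OF assms(1) that]
        branch_time_less_iff add_left_cancel mult_1)
  have "W2 (braided w) (N + h)
      = (\<Sum>f\<in>{q \<in> crossings (braided w). ?P q}. writhe (braided w) f * ?W f)"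
    by (simp add: W2_def f_crossings_def crossing_d_def sum_distrib_left)
  also have "\<dots> = G ?high + (\<Sum>(m, u, v)\<leftarrow>passages w.
      of_bool (m \<noteq> h + 1 \<and> earlier L (u, m) (v, m) \<and> earlier L (u, m) (?high, h + 1))
        * model_r L X (passages w) (m, u, v))"
    unfolding sum_crossings[OF assms(1)] outer sum_passages
    by (intro arg_cong2[of _ _ _ _ "(+)"] refl sum.cong inner) simp
  finally show ?thesis
    unfolding model_W2_def Let_def nth_passages[OF h] distinguished_order[OF assms]
    by (simp only: prod.case) simp
qed

section \<open>Hecke algebra relations in the skein module\<close>

abbreviation null_chains :: "chain set" where
  "null_chains \<equiv> chain.span (skein_relators s t)"

definition skein_eq :: "chain \<Rightarrow> chain \<Rightarrow> bool" (infix "\<approx>" 50) where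
  "p \<approx> q \<longleftrightarrow> p - q \<in> null_chains"

definition inserted :: "nat list \<Rightarrow> chain" where
  "inserted w = single_diagram (insert_braid A a B w)"

lemma skein_eq_refl [simp]: "p \<approx> p"
  by (simp add: skein_eq_def chain.span_zero)

lemma skein_eq_sym: "p \<approx> q \<Longrightarrow> q \<approx> p"
  using chain.span_neg[of "p - q"] by (simp add: skein_eq_def)

lemma skein_eq_trans [trans]: "p \<approx> q \<Longrightarrow> q \<approx> r \<Longrightarrow> p \<approx> r"
  using chain.span_add[of "p - q" _ "q - r"] by (simp add: skein_eq_def)

lemma skein_eq_add: "p \<approx> q \<Longrightarrow> p' \<approx> q' \<Longrightarrow> p + p' \<approx> q + q'"
  using chain.span_add[of "p - q" _ "p' - q'"] by (simp add: skein_eq_def algebra_simps)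

lemma skein_eq_diff: "p \<approx> q \<Longrightarrow> p' \<approx> q' \<Longrightarrow> p - p' \<approx> q - q'"
  using chain.span_diff[of "p - q" _ "p' - q'"] by (simp add: skein_eq_def algebra_simps)

lemma skein_eq_scale: "p \<approx> q \<Longrightarrow> chain_scale c p \<approx> chain_scale c q"
  using chain.span_scale[of "p - q" _ c] by (simp add: skein_eq_def chain.scale_right_diff_distrib)

lemma run_above: "run s A = Some middle" and run_below: "run middle B = Some t"
  using diagram_above diagram_below by (simp_all add: diagram_def)

lemma insert_braid_append:
  "insert_braid A a B (u @ w @ v)
    = (A @ map (braid_slice a) u) @ map (braid_slice a) w @ (map (braid_slice a) v @ B)"
  by (simp add: insert_braid_def)

lemma diagram_insert_braid:
  assumes "set w \<subseteq> {1, 2, 3}"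
  shows "diagram s t (insert_braid A a B w)"
  using run_middle[OF assms]
  by (simp add: diagram_def insert_braid_def run_append run_above run_below del: append.simps)

lemma inserted_local_move:
  assumes "local_move (map (braid_slice a) w) (map (braid_slice a) w')"
    and "set (u @ w @ v) \<subseteq> {1, 2, 3}" "set (u @ w' @ v) \<subseteq> {1, 2, 3}"
  shows "inserted (u @ w @ v) \<approx> inserted (u @ w' @ v)"
  unfolding inserted_def skein_eq_def insert_braid_append
  by (intro chain.span_base skein_relators.regular_isotopy assms(1))
    (simp_all only: insert_braid_append[symmetric] diagram_insert_braid[OF assms(2)]
      diagram_insert_braid[OF assms(3)])

lemma inserted_far:
  assumes "set (u @ v) \<subseteq> {1, 2, 3}"
  shows "inserted (u @ [1, 3] @ v) \<approx> inserted (u @ [3, 1] @ v)"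
proof (rule inserted_local_move)
  show "local_move (map (braid_slice a) [1, 3]) (map (braid_slice a) [3, 1])"
    using far_commutation[of a "Cross True" 0 "Cross True"] by simp
qed (use assms in auto)

lemma inserted_braid:
  assumes "set (u @ v) \<subseteq> {1, 2, 3}" "i \<in> {1, 2}"
  shows "inserted (u @ [i, Suc i, i] @ v) \<approx> inserted (u @ [Suc i, i, Suc i] @ v)"
proof (rule inserted_local_move)
  have "i = Suc (i - 1)"
    using assms(2) by auto
  then have "a + (Suc i - 1) = a + (i - 1) + 1"
    by simp
  then show "local_move (map (braid_slice a) [i, Suc i, i]) (map (braid_slice a) [Suc i, i, Suc i])"
    by (simp only: list.map reidemeister3[of True True True "a + (i - 1)"] simp_thms)
qed (use assms in auto)

text \<open>The quadratic relation of the Hecke algebra: the skein relation at the first of the two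
  crossings, followed by the second Reidemeister move. As both strands run downwards, the smoothing
  is empty.\<close>

lemma inserted_square:
  assumes "set (u @ v) \<subseteq> {1, 2, 3}" "i \<in> {1, 2, 3}"
  shows "inserted (u @ [i, i] @ v) \<approx> inserted (u @ v) + chain_scale laurent_z (inserted (u @ [i] @ v))"
proof -
  let ?j = "a + (i - 1)"
  let ?A = "A @ map (braid_slice a) u" and ?B = "map (braid_slice a) v @ B"
  have u: "set u \<subseteq> {1, 2, 3}" and v: "set v \<subseteq> {1, 2, 3}"
    using assms(1) by auto
  have A: "diagram s middle ?A"
    using run_middle[OF u] by (simp add: diagram_def run_append run_above del: append.simps)
  have B: "diagram middle t ?B"
    using run_middle[OF v] by (simp add: diagram_def run_append run_below del: append.simps)
  have step: "step middle (?j, Cross b) = Some middle" for b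
  proof -
    have "step middle (?j, Cross b) = step middle (braid_slice a i)"
      by (simp only: step.simps)
    then show ?thesis
      using step_middle[OF assms(2)] by (simp only:)
  qed
  \<comment> \<open>Words with negative crossings occur in the intermediate diagrams and have to be
    valid as well.\<close>
  have diag: "diagram s t (?A @ map (\<lambda>b. (?j, Cross b)) bs @ ?B)" for bs
  proof -
    have "run middle (map (\<lambda>b. (?j, Cross b)) bs) = Some middle"
      by (induction bs) (simp_all only: list.map run.simps step bind.simps)
    then show ?thesis
      using A B by (simp add: diagram_def run_append del: append.simps append_assoc)
  qed
  have pos: "middle ! ?j = middle ! (?j + 1)"
    using assms(2) by (auto simp: nth_append)
  have len: "?j + 1 < length middle"
    using assms(2) by auto
  have "single_diagram (?A @ [(?j, Cross True)] @ ((?j, Cross True) # ?B))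
      - single_diagram (?A @ [(?j, Cross (\<not> True))] @ ((?j, Cross True) # ?B))
      - chain_scale laurent_z (single_diagram (?A @ smoothing middle ?j @ ((?j, Cross True) # ?B)))
      \<in> null_chains"
    using diag[of "[True, True]"] pos
    by (intro chain.span_base skein_relators.skein[OF A len]) simp_all
  then have 1: "inserted (u @ [i, i] @ v) - single_diagram (?A @ [(?j, Cross False), (?j, Cross True)] @ ?B)
      - chain_scale laurent_z (inserted (u @ [i] @ v)) \<in> null_chains"
    using pos by (simp add: inserted_def insert_braid_def smoothing_def)
  have "single_diagram (?A @ [(?j, Cross False), (?j, Cross (\<not> False))] @ ?B)
      - single_diagram (?A @ [] @ ?B) \<in> null_chains"
    using diag[of "[False, True]"] diag[of "[]"]
    by (intro chain.span_base skein_relators.regular_isotopy reidemeister2) simp_all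
  then have 2: "single_diagram (?A @ [(?j, Cross False), (?j, Cross True)] @ ?B) - inserted (u @ v) \<in> null_chains"
    by (simp add: inserted_def insert_braid_def)
  from chain.span_add[OF 1 2] show ?thesis
    by (simp add: skein_eq_def algebra_simps)
qed

lemma inserted_braid12: "set (u @ v) \<subseteq> {1, 2, 3} \<Longrightarrow> inserted (u @ [1, 2, 1] @ v) \<approx> inserted (u @ [2, 1, 2] @ v)"
  and inserted_braid23: "set (u @ v) \<subseteq> {1, 2, 3} \<Longrightarrow> inserted (u @ [2, 3, 2] @ v) \<approx> inserted (u @ [3, 2, 3] @ v)"
  using inserted_braid[of u v 1] inserted_braid[of u v 2] by (simp_all add: numeral_2_eq_2 numeral_3_eq_3)

text \<open>The left word replaces \<open>P\<^sub>3\<close> and \<open>P\<^sub>4\<close> by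
  \<open>\<sigma>\<^sub>2\<sigma>\<^sub>1\<close>, the right one \<open>P\<^sub>3'\<close> and
  \<open>P\<^sub>4'\<close>.\<close>

lemma inserted_21321_32132: "inserted [2, 1, 3, 2, 1] \<approx> inserted [3, 2, 1, 3, 2]"
proof -
  have "inserted [2, 1, 3, 2, 1] \<approx> inserted [2, 3, 1, 2, 1]"
    using inserted_far[of "[2]" "[2, 1]"] by simp
  also have "\<dots> \<approx> inserted [2, 3, 2, 1, 2]"
    using inserted_braid12[of "[2, 3]" "[]"] by simp
  also have "\<dots> \<approx> inserted [3, 2, 3, 1, 2]"
    using inserted_braid23[of "[]" "[1, 2]"] by simp
  also have "\<dots> \<approx> inserted [3, 2, 1, 3, 2]"
    using skein_eq_sym[OF inserted_far[of "[3, 2]" "[2]"]] by simp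
  finally show ?thesis .
qed

lemma inserted_32123_12321: "inserted [3, 2, 1, 2, 3] \<approx> inserted [1, 2, 3, 2, 1]"
proof -
  have "inserted [3, 2, 1, 2, 3] \<approx> inserted [3, 1, 2, 1, 3]"
    using skein_eq_sym[OF inserted_braid12[of "[3]" "[3]"]] by simp
  also have "\<dots> \<approx> inserted [1, 3, 2, 1, 3]"
    using skein_eq_sym[OF inserted_far[of "[]" "[2, 1, 3]"]] by simp
  also have "\<dots> \<approx> inserted [1, 3, 2, 3, 1]"
    using inserted_far[of "[1, 3, 2]" "[]"] by simp
  also have "\<dots> \<approx> inserted [1, 2, 3, 2, 1]"
    using skein_eq_sym[OF inserted_braid23[of "[1]" "[1]"]] by simp
  finally show ?thesis .
qed

lemma inserted_3123_1232: "inserted [3, 1, 2, 3] \<approx> inserted [1, 2, 3, 2]"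
proof -
  have "inserted [3, 1, 2, 3] \<approx> inserted [1, 3, 2, 3]"
    using skein_eq_sym[OF inserted_far[of "[]" "[2, 3]"]] by simp
  also have "\<dots> \<approx> inserted [1, 2, 3, 2]"
    using skein_eq_sym[OF inserted_braid23[of "[1]" "[]"]] by simp
  finally show ?thesis .
qed

lemma inserted_2123_1231: "inserted [2, 1, 2, 3] \<approx> inserted [1, 2, 3, 1]"
proof -
  have "inserted [2, 1, 2, 3] \<approx> inserted [1, 2, 1, 3]"
    using skein_eq_sym[OF inserted_braid12[of "[]" "[3]"]] by simp
  also have "\<dots> \<approx> inserted [1, 2, 3, 1]"
    using inserted_far[of "[1, 2]" "[]"] by simp
  finally show ?thesis .
qed

lemma inserted_3213_2321: "inserted [3, 2, 1, 3] \<approx> inserted [2, 3, 2, 1]"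
proof -
  have "inserted [3, 2, 1, 3] \<approx> inserted [3, 2, 3, 1]"
    using inserted_far[of "[3, 2]" "[]"] by simp
  also have "\<dots> \<approx> inserted [2, 3, 2, 1]"
    using skein_eq_sym[OF inserted_braid23[of "[]" "[1]"]] by simp
  finally show ?thesis .
qed

lemma inserted_3212_1321: "inserted [3, 2, 1, 2] \<approx> inserted [1, 3, 2, 1]"
proof -
  have "inserted [3, 2, 1, 2] \<approx> inserted [3, 1, 2, 1]"
    using skein_eq_sym[OF inserted_braid12[of "[3]" "[]"]] by simp
  also have "\<dots> \<approx> inserted [1, 3, 2, 1]"
    using skein_eq_sym[OF inserted_far[of "[]" "[2, 1]"]] by simp
  finally show ?thesis .
qed

lemma inserted_23213_22321: "inserted [2, 3, 2, 1, 3] \<approx> inserted [2, 2, 3, 2, 1]"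
proof -
  have "inserted [2, 3, 2, 1, 3] \<approx> inserted [2, 3, 2, 3, 1]"
    using inserted_far[of "[2, 3, 2]" "[]"] by simp
  also have "\<dots> \<approx> inserted [2, 2, 3, 2, 1]"
    using skein_eq_sym[OF inserted_braid23[of "[2]" "[1]"]] by simp
  finally show ?thesis .
qed

lemma inserted_13212_11321: "inserted [1, 3, 2, 1, 2] \<approx> inserted [1, 1, 3, 2, 1]"
proof -
  have "inserted [1, 3, 2, 1, 2] \<approx> inserted [1, 3, 1, 2, 1]"
    using skein_eq_sym[OF inserted_braid12[of "[1, 3]" "[]"]] by simp
  also have "\<dots> \<approx> inserted [1, 1, 3, 2, 1]"
    using skein_eq_sym[OF inserted_far[of "[1]" "[2, 1]"]] by simp
  finally show ?thesis .
qed

lemma inserted_2131_2113: "inserted [2, 1, 3, 1] \<approx> inserted [2, 1, 1, 3]"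
  using skein_eq_sym[OF inserted_far[of "[2, 1]" "[]"]] by simp

lemma inserted_1312_1132: "inserted [1, 3, 1, 2] \<approx> inserted [1, 1, 3, 2]"
  using skein_eq_sym[OF inserted_far[of "[1]" "[2]"]] by simp

lemma inserted_2121_2212: "inserted [2, 1, 2, 1] \<approx> inserted [2, 2, 1, 2]"
  using inserted_braid12[of "[2]" "[]"] by simp

lemma inserted_1212_1121: "inserted [1, 2, 1, 2] \<approx> inserted [1, 1, 2, 1]"
  using skein_eq_sym[OF inserted_braid12[of "[1]" "[]"]] by simp

lemma inserted_2323_2232: "inserted [2, 3, 2, 3] \<approx> inserted [2, 2, 3, 2]"
  using skein_eq_sym[OF inserted_braid23[of "[2]" "[]"]] by simp

lemma inserted_3232_3323: "inserted [3, 2, 3, 2] \<approx> inserted [3, 3, 2, 3]"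
  using inserted_braid23[of "[3]" "[]"] by simp

lemma inserted_2313_2133: "inserted [2, 3, 1, 3] \<approx> inserted [2, 1, 3, 3]"
  using skein_eq_sym[OF inserted_far[of "[2]" "[3]"]] by simp

lemma inserted_3132_1332: "inserted [3, 1, 3, 2] \<approx> inserted [1, 3, 3, 2]"
  using skein_eq_sym[OF inserted_far[of "[]" "[3, 2]"]] by simp

text \<open>The replacements of \<open>P\<^sub>1'\<close> and \<open>P\<^sub>1\<close> by
  \<open>\<sigma>\<^sub>2\<sigma>\<^sub>1\<close> are not equal braids. They are 22321 and 11321,
  and resolving the squares leaves the second-sum term of \<open>P\<^sub>3\<close> as their
  difference.\<close>

lemma inserted_23213_13212:
  "inserted [2, 3, 2, 1, 3] - inserted [1, 3, 2, 1, 2] - chain_scale laurent_z (inserted [2, 3, 2, 1] - inserted [1, 3, 2, 1]) \<approx> 0"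
proof -
  have "inserted [2, 3, 2, 1, 3] \<approx> inserted [3, 2, 1] + chain_scale laurent_z (inserted [2, 3, 2, 1])"
    using skein_eq_trans[OF inserted_23213_22321] inserted_square[of "[]" "[3, 2, 1]" 2] by simp
  moreover have "inserted [1, 3, 2, 1, 2] \<approx> inserted [3, 2, 1] + chain_scale laurent_z (inserted [1, 3, 2, 1])"
    using skein_eq_trans[OF inserted_13212_11321] inserted_square[of "[]" "[3, 2, 1]" 1] by simp
  ultimately show ?thesis
    using skein_eq_diff by (fastforce simp: skein_eq_def chain.scale_right_diff_distrib algebra_simps)
qed

text \<open>The second-sum terms of the four triple crossings with equal \<open>W\<^sub>2\<close>.
  Each of the eight words contains a square after braid moves; once the squares are resolved,
  everything cancels.\<close>

lemma inserted_2131_3132: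
  "(inserted [2, 1, 3, 1] - inserted [2, 1, 2, 1]) + (inserted [2, 3, 2, 3] - inserted [2, 3, 1, 3])
    - (inserted [3, 2, 3, 2] - inserted [3, 1, 3, 2]) - (inserted [1, 3, 1, 2] - inserted [1, 2, 1, 2]) \<approx> 0"
proof -
  let ?z = "chain_scale laurent_z"
  have "inserted [2, 1, 3, 1] \<approx> inserted [2, 3] + ?z (inserted [2, 1, 3])"
    using skein_eq_trans[OF inserted_2131_2113] inserted_square[of "[2]" "[3]" 1] by simp
  moreover have "inserted [2, 1, 2, 1] \<approx> inserted [1, 2] + ?z (inserted [2, 1, 2])"
    using skein_eq_trans[OF inserted_2121_2212] inserted_square[of "[]" "[1, 2]" 2] by simp
  moreover have "inserted [2, 3, 2, 3] \<approx> inserted [3, 2] + ?z (inserted [2, 3, 2])"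
    using skein_eq_trans[OF inserted_2323_2232] inserted_square[of "[]" "[3, 2]" 2] by simp
  moreover have "inserted [2, 3, 1, 3] \<approx> inserted [2, 1] + ?z (inserted [2, 1, 3])"
    using skein_eq_trans[OF inserted_2313_2133] inserted_square[of "[2, 1]" "[]" 3] by simp
  \<comment> \<open>A further braid move turns 323 into 232, which cancels against the word
    2323.\<close>
  moreover have "inserted [3, 2, 3, 2] \<approx> inserted [2, 3] + ?z (inserted [2, 3, 2])"
  proof -
    have "inserted [3, 2, 3, 2] \<approx> inserted [2, 3] + ?z (inserted [3, 2, 3])"
      using skein_eq_trans[OF inserted_3232_3323] inserted_square[of "[]" "[2, 3]" 3] by simp
    also have "\<dots> \<approx> inserted [2, 3] + ?z (inserted [2, 3, 2])"
      using inserted_braid23[of "[]" "[]"] by (intro skein_eq_add skein_eq_scale) (simp_all add: skein_eq_sym)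
    finally show ?thesis .
  qed
  moreover have "inserted [3, 1, 3, 2] \<approx> inserted [1, 2] + ?z (inserted [1, 3, 2])"
    using skein_eq_trans[OF inserted_3132_1332] inserted_square[of "[1]" "[2]" 3] by simp
  moreover have "inserted [1, 3, 1, 2] \<approx> inserted [3, 2] + ?z (inserted [1, 3, 2])"
    using skein_eq_trans[OF inserted_1312_1132] inserted_square[of "[]" "[3, 2]" 1] by simp
  moreover have "inserted [1, 2, 1, 2] \<approx> inserted [2, 1] + ?z (inserted [2, 1, 2])"
  proof -
    have "inserted [1, 2, 1, 2] \<approx> inserted [2, 1] + ?z (inserted [1, 2, 1])"
      using skein_eq_trans[OF inserted_1212_1121] inserted_square[of "[]" "[2, 1]" 1] by simp
    also have "\<dots> \<approx> inserted [2, 1] + ?z (inserted [2, 1, 2])"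
      using inserted_braid12[of "[]" "[]"] by (intro skein_eq_add skein_eq_scale) simp_all
    finally show ?thesis .
  qed
  ultimately have "(inserted [2, 1, 3, 1] - inserted [2, 1, 2, 1]) + (inserted [2, 3, 2, 3] - inserted [2, 3, 1, 3])
      - (inserted [3, 2, 3, 2] - inserted [3, 1, 3, 2]) - (inserted [1, 3, 1, 2] - inserted [1, 2, 1, 2])
    \<approx> (inserted [2, 3] + ?z (inserted [2, 1, 3]) - (inserted [1, 2] + ?z (inserted [2, 1, 2])))
      + (inserted [3, 2] + ?z (inserted [2, 3, 2]) - (inserted [2, 1] + ?z (inserted [2, 1, 3])))
      - (inserted [2, 3] + ?z (inserted [2, 3, 2]) - (inserted [1, 2] + ?z (inserted [1, 3, 2])))
      - (inserted [3, 2] + ?z (inserted [1, 3, 2]) - (inserted [2, 1] + ?z (inserted [2, 1, 2])))"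
    by (intro skein_eq_add skein_eq_diff)
  then show ?thesis
    by simp
qed

section \<open>Assembly of the sum over the meridian\<close>

text \<open>
  The sign of each triple crossing, the diagram next to it with the position of its triangle,
  and its replacements by \<open>\<sigma>\<^sub>2\<sigma>\<^sub>1\<close>, \<open>\<sigma>\<^sub>2\<close> and \<open>\<sigma>\<^sub>1\<close>.
\<close>

lemma meridian_words:
  "map (\<lambda>p. (sign_of p, replace_triple p [1, 2, 1], length (before p),
      replace_triple p [2, 1], replace_triple p [2], replace_triple p [1])) meridian =
   [(1, [1, 2, 1, 3, 2, 1], 0, [2, 1, 3, 2, 1], [2, 3, 2, 1], [1, 3, 2, 1]),
    (1, [2, 1, 2, 3, 2, 1], 2, [2, 1, 3, 2, 1], [2, 1, 3, 1], [2, 1, 2, 1]),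
    (1, [2, 3, 1, 2, 1, 3], 2, [2, 3, 2, 1, 3], [2, 3, 2, 3], [2, 3, 1, 3]),
    (1, [2, 3, 2, 1, 2, 3], 0, [3, 2, 1, 2, 3], [3, 1, 2, 3], [2, 1, 2, 3]),
    (-1, [3, 2, 1, 2, 3, 2], 3, [3, 2, 1, 3, 2], [3, 2, 1, 3], [3, 2, 1, 2]),
    (-1, [3, 1, 2, 1, 3, 2], 1, [3, 2, 1, 3, 2], [3, 2, 3, 2], [3, 1, 3, 2]),
    (-1, [1, 2, 3, 2, 1, 2], 1, [1, 3, 2, 1, 2], [1, 3, 1, 2], [1, 2, 1, 2]),
    (-1, [1, 2, 3, 1, 2, 1], 3, [1, 2, 3, 2, 1], [1, 2, 3, 2], [1, 2, 3, 1])]"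
  by (simp add: meridian_def replace_triple_def numeral_eq_Suc)

lemma W1_W2_meridian:
  assumes "p \<in> set meridian"
  shows "(if global_type_lc (perturbed s A a B \<sigma> x p) (triangle A p) \<or>
        global_type_ra (perturbed s A a B \<sigma> x p) (triangle A p)
      then W1 (perturbed s A a B \<sigma> x p) (triangle A p) else 0)
    = model_W1 L X (passages (replace_triple p [1, 2, 1])) (length (before p))"
    and "(if type_0 (perturbed s A a B \<sigma> x p) (crossing_d (triangle A p))
      then W2 (perturbed s A a B \<sigma> x p) (triangle A p) else 0)
    = model_W2 L X G (passages (replace_triple p [1, 2, 1])) (length (before p))"
proof -
  let ?w = "replace_triple p [1, 2, 1]" and ?h = "length (before p)"
  have E: "perturbed s A a B \<sigma> x p = braided ?w" "triangle A p = N + ?h"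
    by (simp_all add: perturbed_def braided_def triangle_def)
  have "(sign_of p, ?w, ?h, replace_triple p [2, 1], replace_triple p [2], replace_triple p [1])
      \<in> (\<lambda>p. (sign_of p, replace_triple p [1, 2, 1], length (before p), replace_triple p [2, 1],
          replace_triple p [2], replace_triple p [1])) ` set meridian"
    using assms by (rule imageI)
  note word = this[unfolded set_map[symmetric] meridian_words list.set]
  have w: "half_twist ?w"
    using word meridian_half_twist by (elim insertE emptyE) (simp_all only: prod.inject)
  have h: "?h \<le> 3"
    using word by (elim insertE emptyE) simp_all
  have mid: "over_branch ?w ?h \<noteq> under_branch ?w (?h + 1)" "over_branch ?w ?h \<noteq> over_branch ?w (?h + 1)"
    using word by (elim insertE emptyE; simp add: over_branch_def under_branch_def place_def transpose_def)+
  show "(if global_type_lc (perturbed s A a B \<sigma> x p) (triangle A p) \<or>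
        global_type_ra (perturbed s A a B \<sigma> x p) (triangle A p)
      then W1 (perturbed s A a B \<sigma> x p) (triangle A p) else 0) = model_W1 L X (passages ?w) ?h"
    unfolding E by (rule W1_eq[OF w h mid])
  show "(if type_0 (perturbed s A a B \<sigma> x p) (crossing_d (triangle A p))
      then W2 (perturbed s A a B \<sigma> x p) (triangle A p) else 0) = model_W2 L X G (passages ?w) ?h"
    unfolding E by (rule W2_eq[OF w h])
qed

text \<open>The model weights vanish where a triple crossing is left out, so both filtered sums
  become one sum over all eight.\<close>

lemma R1_meridian_eq:
  "R1_meridian s A a B \<sigma> x =
    (\<Sum>(\<epsilon>, w, h, \<beta>\<^sub>2\<^sub>1, \<beta>\<^sub>2, \<beta>\<^sub>1)\<leftarrow>
        map (\<lambda>p. (sign_of p, replace_triple p [1, 2, 1], length (before p),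
          replace_triple p [2, 1], replace_triple p [2], replace_triple p [1])) meridian.
      chain_scale (of_int (\<epsilon> * model_W1 L X (passages w) h)) (inserted \<beta>\<^sub>2\<^sub>1)
      + chain_scale (laurent_z * of_int (\<epsilon> * model_W2 L X G (passages w) h)) (inserted \<beta>\<^sub>2 - inserted \<beta>\<^sub>1))"
  unfolding R1_meridian_def Let_def sum_list_map_filter' smoothed_def inserted_def[symmetric]
    sum_list_addf[symmetric] map_map comp_def prod.case
  by (intro arg_cong2[of _ _ _ _ "(+)"] arg_cong[of _ _ sum_list] map_cong refl)
    (auto simp: W1_W2_meridian[symmetric] mult.assoc mult.left_commute simp del: One_nat_def)

lemma R1_meridian_null: "R1_meridian s A a B \<sigma> x \<in> null_chains"
proof -
  interpret branch_order L
    by (rule branch_order_L)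
  define \<alpha> :: "nat list \<Rightarrow> nat \<Rightarrow> laurent" where "\<alpha> w h = of_int (model_W1 L X (passages w) h)" for w h
  define \<beta> :: "nat list \<Rightarrow> nat \<Rightarrow> laurent" where "\<beta> w h = of_int (model_W2 L X G (passages w) h)" for w h
  \<comment> \<open>The values that determine all others; the index is the place of the triple
    crossing in \<open>meridian\<close>.\<close>
  define \<alpha>1 where "\<alpha>1 = \<alpha> [1, 2, 1, 3, 2, 1] 0"
  define \<alpha>2 where "\<alpha>2 = \<alpha> [2, 1, 2, 3, 2, 1] 2"
  define \<alpha>3 where "\<alpha>3 = \<alpha> [2, 3, 1, 2, 1, 3] 2"
  define \<alpha>4 where "\<alpha>4 = \<alpha> [2, 3, 2, 1, 2, 3] 0"
  define \<alpha>5 where "\<alpha>5 = \<alpha> [3, 2, 1, 2, 3, 2] 3"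
  define \<beta>1 where "\<beta>1 = \<beta> [1, 2, 1, 3, 2, 1] 0"
  define \<beta>2 where "\<beta>2 = \<beta> [2, 1, 2, 3, 2, 1] 2"
  define \<beta>4 where "\<beta>4 = \<beta> [2, 3, 2, 1, 2, 3] 0"
  have \<alpha>: "\<alpha> [1, 2, 1, 3, 2, 1] 0 = \<alpha>1" "\<alpha> [2, 1, 2, 3, 2, 1] 2 = \<alpha>2"
    "\<alpha> [2, 3, 1, 2, 1, 3] 2 = \<alpha>3" "\<alpha> [2, 3, 2, 1, 2, 3] 0 = \<alpha>4" "\<alpha> [3, 2, 1, 2, 3, 2] 3 = \<alpha>5"
    "\<alpha> [3, 1, 2, 1, 3, 2] 1 = \<alpha>1 + \<alpha>2 - \<alpha>5" "\<alpha> [1, 2, 3, 2, 1, 2] 1 = \<alpha>3"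
    "\<alpha> [1, 2, 3, 1, 2, 1] 3 = \<alpha>4"
    unfolding \<alpha>1_def \<alpha>2_def \<alpha>3_def \<alpha>4_def \<alpha>5_def
    by (simp_all only: \<alpha>_def W1_P1[symmetric] W1_P2[symmetric] W1_P3_P4 of_int_add
        of_int_diff)
  have \<beta>: "\<beta> [1, 2, 1, 3, 2, 1] 0 = \<beta>1" "\<beta> [2, 1, 2, 3, 2, 1] 2 = \<beta>2"
    "\<beta> [2, 3, 1, 2, 1, 3] 2 = \<beta>2" "\<beta> [2, 3, 2, 1, 2, 3] 0 = \<beta>4" "\<beta> [3, 2, 1, 2, 3, 2] 3 = \<alpha>3 + \<beta>1"
    "\<beta> [3, 1, 2, 1, 3, 2] 1 = \<beta>2" "\<beta> [1, 2, 3, 2, 1, 2] 1 = \<beta>2" "\<beta> [1, 2, 3, 1, 2, 1] 3 = \<beta>4"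
    unfolding \<alpha>3_def \<beta>1_def \<beta>2_def \<beta>4_def
    by (simp_all only: \<alpha>_def \<beta>_def W2_P1[symmetric] W2_P2[symmetric] W2_P4[symmetric]
        W2_P4_P1[symmetric] W1_P1_W2[symmetric] of_int_add)
  let ?z = "chain_scale laurent_z"
  \<comment> \<open>Grouped by independent coefficients, so that each bracket is null. The value
    \<open>\<alpha>5\<close> drops out, as \<open>P\<^sub>3'\<close> and \<open>P\<^sub>4'\<close>
    have the same replacement. The term with \<open>z\<close> in the bracket of
    \<open>\<alpha>3\<close> compensates for the \<open>\<alpha>3\<close> in the coefficient
    \<open>\<alpha>3 + \<beta>1\<close>.\<close>
  have "R1_meridian s A a B \<sigma> x =
      chain_scale (\<alpha>1 + \<alpha>2) (inserted [2, 1, 3, 2, 1] - inserted [3, 2, 1, 3, 2])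
    + chain_scale \<alpha>4 (inserted [3, 2, 1, 2, 3] - inserted [1, 2, 3, 2, 1])
    + chain_scale \<alpha>3 (inserted [2, 3, 2, 1, 3] - inserted [1, 3, 2, 1, 2] - ?z (inserted [2, 3, 2, 1] - inserted [1, 3, 2, 1]))
    + chain_scale (laurent_z * \<beta>4) ((inserted [3, 1, 2, 3] - inserted [1, 2, 3, 2]) - (inserted [2, 1, 2, 3] - inserted [1, 2, 3, 1]))
    - chain_scale (laurent_z * (\<alpha>3 + \<beta>1))
        ((inserted [3, 2, 1, 3] - inserted [2, 3, 2, 1]) - (inserted [3, 2, 1, 2] - inserted [1, 3, 2, 1]))
    + chain_scale (laurent_z * \<beta>2)
        ((inserted [2, 1, 3, 1] - inserted [2, 1, 2, 1]) + (inserted [2, 3, 2, 3] - inserted [2, 3, 1, 3])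
          - (inserted [3, 2, 3, 2] - inserted [3, 1, 3, 2]) - (inserted [1, 3, 1, 2] - inserted [1, 2, 1, 2]))"
    unfolding R1_meridian_eq meridian_words
    by (simp add: \<alpha>_def[symmetric] \<beta>_def[symmetric] \<alpha> \<beta> chain.scale_left_distrib chain.scale_left_diff_distrib
        chain.scale_right_distrib chain.scale_right_diff_distrib algebra_simps del: One_nat_def)
  also have "\<dots> \<in> null_chains"
    using inserted_21321_32132 inserted_32123_12321 inserted_23213_13212 inserted_3123_1232 inserted_2123_1231 inserted_3213_2321 inserted_3212_1321
      inserted_2131_3132
    unfolding skein_eq_def diff_0_right
    by - (assumption | rule chain.span_add chain.span_diff chain.span_scale)+
  finally show ?thesis .
qed

end

theorem proposition3:
  fixes n :: nat
    and s t left right :: "bool list"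
    and A B :: "slice list"
    and \<sigma> :: "bpoint \<Rightarrow> bpoint"
    and x :: bpoint
  assumes "diagram s (left @ [True, True, True, True] @ right) A"
    and "diagram (left @ [True, True, True, True] @ right) t B"
    and "closed_string_link n t
           \<lparr>source = s, slices = insert_braid A (length left) B [1, 2, 1, 3, 2, 1],
            arcs = \<sigma>, infty = x\<rparr>"
  shows "skein_class s t (R1_meridian s A (length left) B \<sigma> x) = skein_class s t 0"
proof -
  interpret quadruple_crossing n s t left right A B \<sigma> x
    using assms by unfold_locales
  show ?thesis
    using chain.span_add[OF _ R1_meridian_null] chain.span_diff[OF _ R1_meridian_null]
    unfolding skein_class_def by fastforce
qed

end
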